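(* Let $y=X\beta$ (noiseless measurements). Suppose that the $n\times p$ design matrix $X$ satisfies the strong coherence property and choose the threshold $\lambda=10\,\mu\,\|y\|_2\sqrt{\dfrac{2\log p}{1-\mathrm e^{-1/2}}}$, where $\mu=\mu(X)$, for any $p\ge128$. Then the output $\widehat\beta$ of the OST algorithm for sparse-signal recovery with threshold $\lambda$ satisfies $\Pr(\widehat\beta\ne\beta)\le 6p^{-1}$ as long as $$k\le\min\Bigg\{\frac{p}{c_3^2\,\|X\|_2^2\,\log p},\ \frac{\mu^{-2}\,\mathrm{MAR}}{c_4^2\log p}\Bigg\},$$ where $c_3=37\mathrm e$ and $c_4=43$. Here the probability is only with respect to the true model $\mathcal S$ (the locations of the nonzero entries of $\beta$).
   Context: Setting. $k<n\le p$ are positive integers, $X$ is a fixed real- or complex-valued $n\times p$ matrix whose columns $\mathrm{x}_1,\dots,\mathrm{x}_p$ have unit $\ell_2$-norm, $\|X\|_2$ is its spectral norm, $\log$ is the natural logarithm, and $\mathrm e$ is its base. Signal model. The signal $\beta\in\mathbb C^p$ is $k$-sparse with uniformly random support: there are a fixed vector $z\in\mathbb C^k$ with all entries nonzero and a uniformly random permutation $(\pi_1,\dots,\pi_p)$ of $\{1,\dots,p\}$ with $\beta_{\pi_i}=z_i$ for $i\le k$ and all other entries of $\beta$ equal to $0$. The true model is $\mathcal S=\{i:|\beta_i|>0\}=\{\pi_1,\dots,\pi_k\}$. Also $\beta_{\min}=\min_{i\in\mathcal S}|\beta_i|$ and $\mathrm{MAR}=\frac{\beta_{\min}^2}{\|\beta\|_2^2/k}$.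 Coherence. $\mu(X)=\max_{i\ne j}|\langle \mathrm{x}_i,\mathrm{x}_j\rangle|$ and $\nu(X)=\frac1{p-1}\max_i\big|\sum_{j\neq i}\langle \mathrm{x}_i,\mathrm{x}_j\rangle\big|$. $X$ satisfies the strong coherence property if $\mu(X)\le\frac{1}{60\,\mathrm e\log p}$ and $\nu(X)\le\frac{\mu(X)}{\sqrt n}$. ($\mu^{-2}=\infty$ if $\mu=0$.) OST algorithm for sparse-signal recovery. Given $X$, $y$ and $\lambda$: set $\widehat\beta=\mathbf 0\in\mathbb C^p$, compute $f=X^{\mathrm H}y$, let $\mathcal I=\{i\in\{1,\dots,p\}:|f_i|>\lambda\}$, and set $\widehat\beta_{\mathcal I}=(X_{\mathcal I})^\dagger y$, where $X_{\mathcal I}$ is the submatrix of columns of $X$ indexed by $\mathcal I$, $\widehat\beta_{\mathcal I}$ is the part of $\widehat\beta$ indexed by $\mathcal I$, and $\dagger$ is the Moore–Penrose pseudoinverse. *)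

theory Defs
  imports
    "HOL-Analysis.Analysis"
    "HOL-Probability.Probability"
    "HOL-Combinatorics.Multiset_Permutations"
begin

section \<open>Matrices and coherence\<close>

text \<open>
  An \<open>n \<times> p\<close> matrix has type \<open>complex ^ 'p ^ 'n\<close>, with \<open>n = CARD('n)\<close> and \<open>p = CARD('p)\<close>.
  A real-valued matrix is the special case in which all entries are real.
\<close>

definition hinner :: "complex ^ 'n \<Rightarrow> complex ^ 'n \<Rightarrow> complex" where
  "hinner u v = (\<Sum>i\<in>UNIV. cnj (u $ i) * v $ i)"

definition hermitian_transpose :: "complex ^ 'p ^ 'n \<Rightarrow> complex ^ 'n ^ 'p" where
  "hermitian_transpose X = (\<chi> j i. cnj (X $ i $ j))"

text \<open>
  The norm on \<open>complex ^ 'm\<close> is the Euclidean one, so the operator norm is the largest singular value.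
\<close>

definition spectral_norm :: "complex ^ 'p ^ 'n \<Rightarrow> real" where
  "spectral_norm X = onorm ((*v) X)"

definition worst_case_coherence :: "complex ^ 'p ^ 'n \<Rightarrow> real" where
  "worst_case_coherence X =
     Max {cmod (hinner (column i X) (column j X)) | i j. i \<noteq> j}"

definition average_coherence :: "complex ^ 'p ^ 'n \<Rightarrow> real" where
  "average_coherence X =
     1 / (real CARD('p) - 1) *
     Max (range (\<lambda>i. cmod (\<Sum>j\<in>UNIV - {i}. hinner (column i X) (column j X))))"

definition strong_coherence_property :: "complex ^ 'p ^ 'n \<Rightarrow> bool" where
  "strong_coherence_property X \<longleftrightarrow>
     worst_case_coherence X \<le> 1 / (60 * exp 1 * ln (real CARD('p))) \<and>
     average_coherence X \<le> worst_case_coherence X / sqrt (real CARD('n))"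


section \<open>Signal model\<close>

text \<open>
  A permutation of the column indices is a duplicate-free list \<open>\<pi>\<close> enumerating all of them;
  positions are counted from \<open>0\<close>, and only \<open>z 0, \<dots>, z (k - 1)\<close> are used.
  As \<open>\<pi>\<close> is duplicate-free, at most one summand below is nonzero; the two lemmas spell this out.
\<close>

definition signal :: "nat \<Rightarrow> (nat \<Rightarrow> complex) \<Rightarrow> 'p list \<Rightarrow> complex ^ 'p" where
  "signal k z \<pi> = (\<chi> j. \<Sum>i<k. if \<pi> ! i = j then z i else 0)"

lemma signal_nth:
  assumes "distinct \<pi>" "k \<le> length \<pi>" "i < k"
  shows "signal k z \<pi> $ (\<pi> ! i) = z i"
proof -
  have "signal k z \<pi> $ (\<pi> ! i) = (\<Sum>l<k. if l = i then z l else 0)"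
    unfolding signal_def using assms
    by (auto intro!: sum.cong simp: nth_eq_iff_index_eq)
  with \<open>i < k\<close> show ?thesis by simp
qed

lemma signal_eq_0:
  assumes "\<And>i. i < k \<Longrightarrow> \<pi> ! i \<noteq> j"
  shows "signal k z \<pi> $ j = 0"
  using assms by (simp add: signal_def)

definition true_model :: "complex ^ 'p \<Rightarrow> 'p set" where
  "true_model \<beta> = {i. cmod (\<beta> $ i) > 0}"

definition beta_min :: "complex ^ 'p \<Rightarrow> real" where
  "beta_min \<beta> = Min ((\<lambda>i. cmod (\<beta> $ i)) ` true_model \<beta>)"

definition MAR :: "nat \<Rightarrow> complex ^ 'p \<Rightarrow> real" where
  "MAR k \<beta> = (beta_min \<beta>)\<^sup>2 / ((norm \<beta>)\<^sup>2 / real k)"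


section \<open>Moore--Penrose pseudoinverse of a submatrix\<close>

text \<open>
  The columns selected by thresholding vary with the data, so their number cannot be a type.
  Matrices in this section are functions read on explicit finite row and column index sets.
  The pseudoinverse is pinned down by the four Penrose equations; it is set to \<open>0\<close> outside the
  index sets, which makes it unique as a function.
\<close>

definition mprod :: "'b set \<Rightarrow> ('a \<Rightarrow> 'b \<Rightarrow> complex) \<Rightarrow> ('b \<Rightarrow> 'c \<Rightarrow> complex) \<Rightarrow> 'a \<Rightarrow> 'c \<Rightarrow> complex" where
  "mprod B M N = (\<lambda>a c. \<Sum>b\<in>B. M a b * N b c)"

definition is_pseudoinverse ::
  "'r set \<Rightarrow> 'c set \<Rightarrow> ('r \<Rightarrow> 'c \<Rightarrow> complex) \<Rightarrow> ('c \<Rightarrow> 'r \<Rightarrow> complex) \<Rightarrow> bool" where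
  "is_pseudoinverse R C M G \<longleftrightarrow>
     (\<forall>r\<in>R. \<forall>c\<in>C. mprod R (mprod C M G) M r c = M r c) \<and>
     (\<forall>c\<in>C. \<forall>r\<in>R. mprod C (mprod R G M) G c r = G c r) \<and>
     (\<forall>r\<in>R. \<forall>s\<in>R. cnj (mprod C M G s r) = mprod C M G r s) \<and>
     (\<forall>c\<in>C. \<forall>d\<in>C. cnj (mprod R G M d c) = mprod R G M c d) \<and>
     (\<forall>c r. c \<notin> C \<or> r \<notin> R \<longrightarrow> G c r = 0)"

definition pseudoinverse ::
  "'r set \<Rightarrow> 'c set \<Rightarrow> ('r \<Rightarrow> 'c \<Rightarrow> complex) \<Rightarrow> 'c \<Rightarrow> 'r \<Rightarrow> complex" where
  "pseudoinverse R C M = (THE G. is_pseudoinverse R C M G)"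


section \<open>One-step thresholding\<close>

definition ost_model :: "complex ^ 'p ^ 'n \<Rightarrow> complex ^ 'n \<Rightarrow> real \<Rightarrow> 'p set" where
  "ost_model X y thr = {i. cmod ((hermitian_transpose X *v y) $ i) > thr}"

definition ost :: "complex ^ 'p ^ 'n \<Rightarrow> complex ^ 'n \<Rightarrow> real \<Rightarrow> complex ^ 'p" where
  "ost X y thr =
     (let I = ost_model X y thr;
          G = pseudoinverse UNIV I (\<lambda>r c. X $ r $ c)
      in \<chi> i. if i \<in> I then \<Sum>r\<in>UNIV. G i r * y $ r else 0)"

definition ost_threshold :: "complex ^ 'p ^ 'n \<Rightarrow> complex ^ 'n \<Rightarrow> real" where
  "ost_threshold X y =
     10 * worst_case_coherence X * norm y *
       sqrt (2 * ln (real CARD('p)) / (1 - exp (- 1 / 2)))"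

end

theory Submission
  imports Defs "HOL-Probability.Hoeffding"
begin

text \<open>
  Write \<open>L = log p\<close>, \<open>x\<^sub>i\<close> for the columns of \<open>X\<close>, \<open>S\<close> for the random support and \<open>f = X\<^sup>H y\<close>. If every
  \<open>f\<^sub>i\<close> is close to \<open>\<beta>\<^sub>i\<close>, thresholding returns exactly \<open>S\<close> (\<open>ost_model_eq_true_model\<close>); if moreover
  the columns in \<open>S\<close> are linearly independent, the pseudoinverse is a left inverse and the output is
  \<open>\<beta>\<close> (\<open>ost_recovers\<close>). So recovery can fail only through a large deviation \<open>f\<^sub>i - \<beta>\<^sub>i\<close> or through a
  dependent support, and both are shown to be rare by scalar exponential moments.
  
  Deviations. With \<open>a\<^sub>i(j) = \<langle>x\<^sub>i, x\<^sub>j\<rangle>\<close> for \<open>j \<noteq> i\<close> and \<open>a\<^sub>i(i) = 0\<close> one has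
  \<open>f\<^sub>i - \<beta>\<^sub>i = \<Sum>\<^sub>j z\<^sub>j a\<^sub>i(\<pi>\<^sub>j)\<close> whether or not \<open>i\<close> lies in the support. This is a weighted sum of values
  drawn without replacement; the values are at most \<open>\<mu>\<close>, and their mean is tiny by the average
  coherence. Drawing one value at a time and applying Hoeffding's lemma at each draw
  (\<open>sampling_without_replacement_mgf\<close>) bounds the probability of a deviation above
  \<open>10 \<mu> \<surd>(2 L) \<parallel>\<beta>\<parallel>\<close> by \<open>4 p\<^sup>-\<^sup>7\<close> for each \<open>i\<close>. The same deviations control \<open>\<parallel>y\<parallel>\<close>: the MAR condition
  implies \<open>43\<^sup>2 k \<mu>\<^sup>2 L \<le> 1\<close>, so \<open>\<parallel>y\<parallel>\<^sup>2\<close> lies within a third of \<open>\<parallel>\<beta>\<parallel>\<^sup>2\<close>, and the threshold, which is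
  proportional to \<open>\<parallel>y\<parallel>\<close>, falls between the largest deviation and \<open>\<beta>\<^sub>m\<^sub>i\<^sub>n\<close> minus that deviation.
  
  Independence. Reveal the support one column at a time and let \<open>q\<^sub>i\<close> be the squared norm of the
  projection of \<open>x\<^sub>i\<close> to the span of the revealed columns. A revealed column \<open>x\<^sub>u\<close> keeps the family
  independent as long as \<open>q\<^sub>u < 1\<close>, and it increases \<open>q\<^sub>i\<close> by \<open>|\<langle>R x\<^sub>u, x\<^sub>i\<rangle>|\<^sup>2 / \<parallel>R x\<^sub>u\<parallel>\<^sup>2\<close>, where \<open>R\<close> is
  the projection to the complement of the span. While all \<open>q\<^sub>i\<close> are at most \<open>1 / L\<close>, each increase is
  at most \<open>2 / L\<^sup>2\<close> because \<open>\<mu> \<le> 1 / (100 L)\<close>, and the increases summed over all \<open>u\<close> are at most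
  a constant times \<open>\<parallel>X\<parallel>\<^sup>2\<close>. Hence the potential \<open>\<Sum>\<^sub>i exp (3 L\<^sup>2 q\<^sub>i)\<close>, which starts at \<open>p\<close>, grows on
  average by at most a factor \<open>p\<close> during \<open>k\<close> steps, whereas some \<open>q\<^sub>i\<close> above \<open>1 / L\<close> needs a potential of
  \<open>p\<^sup>3\<close>. Markov's inequality bounds the probability of dependence by \<open>1 / p\<close>
  (\<open>random_columns_dependent_le\<close>, \<open>prob_support_columns_dependent_le\<close>).
\<close>

section \<open>Averages over permutations\<close>

text \<open>
  The expectation under a uniformly random permutation, as a plain finite sum: inductions that reveal
  the permutation entry by entry then need no measure theory.
\<close>

definition perm_avg :: "'a set \<Rightarrow> ('a list \<Rightarrow> real) \<Rightarrow> real" where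
  "perm_avg A f = (\<Sum>\<pi>\<in>permutations_of_set A. f \<pi>) / fact (card A)"

lemma perm_avg_split_first:
  assumes "finite A" "A \<noteq> {}"
  shows "perm_avg A f = (\<Sum>x\<in>A. perm_avg (A - {x}) (\<lambda>\<pi>. f (x # \<pi>))) / real (card A)"
proof -
  have "(\<Sum>\<pi>\<in>permutations_of_set A. f \<pi>)
      = (\<Sum>x\<in>A. \<Sum>\<pi>\<in>(#) x ` permutations_of_set (A - {x}). f \<pi>)"
    unfolding permutations_of_set_nonempty[OF assms(2)]
    by (rule sum.UNION_disjoint) (use assms in auto)
  also have "\<dots> = (\<Sum>x\<in>A. \<Sum>\<pi>\<in>permutations_of_set (A - {x}). f (x # \<pi>))"
    by (simp add: sum.reindex)
  finally have sums: "(\<Sum>\<pi>\<in>permutations_of_set A. f \<pi>) = \<dots>" .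
  have "fact (card A) = real (card A) * fact (card (A - {x}))" if "x \<in> A" for x
    using assms that by (metis card.remove fact_Suc finite_Diff of_nat_fact of_nat_mult card_Suc_Diff1)
  hence "perm_avg A f = (\<Sum>x\<in>A. (\<Sum>\<pi>\<in>permutations_of_set (A - {x}). f (x # \<pi>)) /
                                (real (card A) * fact (card (A - {x}))))"
    unfolding perm_avg_def sums by (simp add: sum_divide_distrib)
  thus ?thesis
    by (simp add: perm_avg_def sum_divide_distrib mult.commute)
qed

lemma prob_eq_perm_avg:
  assumes "finite A"
  shows "measure_pmf.prob (pmf_of_set (permutations_of_set A)) {\<pi>. P \<pi>} = perm_avg A (\<lambda>\<pi>. of_bool (P \<pi>))"
proof -
  have "measure_pmf.prob (pmf_of_set (permutations_of_set A)) {\<pi>. P \<pi>}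
      = card (permutations_of_set A \<inter> {\<pi>. P \<pi>}) / card (permutations_of_set A)"
    by (rule measure_pmf_of_set) (use assms in auto)
  thus ?thesis using assms
    by (simp add: perm_avg_def of_bool_def sum.If_cases)
qed

lemma perm_avg_mono:
  assumes "\<And>\<pi>. \<pi> \<in> permutations_of_set A \<Longrightarrow> f \<pi> \<le> g \<pi>"
  shows "perm_avg A f \<le> perm_avg A g"
  unfolding perm_avg_def by (intro divide_right_mono sum_mono assms) auto

lemma perm_avg_cmult: "perm_avg A (\<lambda>\<pi>. c * f \<pi>) = c * perm_avg A f"
  by (simp add: perm_avg_def sum_distrib_left)

lemma perm_avg_add: "perm_avg A (\<lambda>\<pi>. f \<pi> + g \<pi>) = perm_avg A f + perm_avg A g"
  by (simp add: perm_avg_def sum.distrib add_divide_distrib)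

lemma perm_avg_sum: "perm_avg A (\<lambda>\<pi>. \<Sum>i\<in>I. f i \<pi>) = (\<Sum>i\<in>I. perm_avg A (f i))"
  by (simp add: perm_avg_def sum.swap[of _ I] sum_divide_distrib)

lemma perm_avg_const: "finite A \<Longrightarrow> perm_avg A (\<lambda>_. c) = c"
  by (simp add: perm_avg_def)

section \<open>Sampling without replacement\<close>

text \<open>
  Hoeffding's lemma for the uniform distribution on a finite set.
\<close>

lemma finite_average_exp_le:
  fixes b :: "'a \<Rightarrow> real"
  assumes "finite A" "A \<noteq> {}" and bound: "\<And>x. x \<in> A \<Longrightarrow> \<bar>b x\<bar> \<le> M"
  shows "(\<Sum>x\<in>A. exp (b x)) / card A \<le> exp ((\<Sum>x\<in>A. b x) / card A + M\<^sup>2 / 2)"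
proof -
  interpret interval_bounded_random_variable "measure_pmf (pmf_of_set A)" b "-M" M
    by unfold_locales (use assms in \<open>auto simp: AE_measure_pmf_iff abs_le_iff intro!: AE_pmfI\<close>,
        (metis abs_le_iff minus_le_iff)+)
  let ?m = "(\<Sum>x\<in>A. b x) / card A"
  have E: "measure_pmf.expectation (pmf_of_set A) b = ?m"
    using assms by (simp add: integral_pmf_of_set)
  have "nn_integral (measure_pmf (pmf_of_set A)) (\<lambda>x. exp (1 * (b x - ?m)))
      \<le> ennreal (exp (1\<^sup>2 * (M - (-M))\<^sup>2 / 8))"
    using Hoeffdings_lemma_nn_integral[of 1] unfolding E by simp
  moreover have "nn_integral (measure_pmf (pmf_of_set A)) (\<lambda>x. exp (1 * (b x - ?m)))
      = ennreal ((\<Sum>x\<in>A. exp (b x - ?m)) / card A)"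
  proof -
    have "nn_integral (measure_pmf (pmf_of_set A)) (\<lambda>x. ennreal (exp (1 * (b x - ?m))))
        = ennreal (measure_pmf.expectation (pmf_of_set A) (\<lambda>x. exp (1 * (b x - ?m))))"
      by (rule nn_integral_eq_integral)
         (use assms in \<open>auto intro!: integrable_measure_pmf_finite simp: set_pmf_of_set[OF assms(2,1)]\<close>)
    thus ?thesis using assms by (simp add: integral_pmf_of_set)
  qed
  ultimately have "(\<Sum>x\<in>A. exp (b x - ?m)) / card A \<le> exp (M\<^sup>2 / 2)"
    by (simp add: power_mult_distrib)
  hence "exp ?m * ((\<Sum>x\<in>A. exp (b x - ?m)) / card A) \<le> exp ?m * exp (M\<^sup>2 / 2)"
    by (intro mult_left_mono) auto
  thus ?thesis
    by (simp add: sum_distrib_left exp_add [symmetric] flip: times_divide_eq_right sum_divide_distrib)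
       (simp add: sum_distrib_left sum_divide_distrib exp_add [symmetric])
qed

text \<open>
  Given the first draw \<open>x\<close>, the conditional mean of the remaining sum is affine in \<open>a x\<close>. The first
  draw therefore enters with its own weight minus an average of the later weights, and Hoeffding's
  lemma applies to it. The constant \<open>c\<close> dominates all these corrections at once: the assumption on the
  sum of the weights passes to the shorter sequence because \<open>card A - r\<close> does not change when one
  element and one weight are removed.
\<close>

lemma sampling_without_replacement_mgf:
  fixes a :: "'a \<Rightarrow> complex" and w :: "nat \<Rightarrow> complex"
  assumes "finite A" "r < card A" "0 \<le> c"
    and "\<And>x. x \<in> A \<Longrightarrow> cmod (a x) \<le> \<mu>"
    and "(\<Sum>j<r. cmod (w j)) \<le> c * (real (card A) - real r)"
  shows "perm_avg A (\<lambda>\<pi>. exp (Re (\<Sum>j<r. w j * a (\<pi> ! j))))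
       \<le> exp (Re ((\<Sum>j<r. w j) * (\<Sum>x\<in>A. a x) / of_nat (card A)) + \<mu>\<^sup>2 / 2 * (\<Sum>j<r. (cmod (w j) + c)\<^sup>2))"
  using assms
proof (induction r arbitrary: w A)
  case 0
  thus ?case by (simp add: perm_avg_const)
next
  case (Suc r)
  define N where "N = card A"
  define s where "s = (\<Sum>x\<in>A. a x)"
  define W where "W = (\<Sum>j<r. w (Suc j))"
  define V where "V = \<mu>\<^sup>2 / 2 * (\<Sum>j<r. (cmod (w (Suc j)) + c)\<^sup>2)"
  \<comment> \<open>Once \<open>x\<close> is drawn, the mean of the values left is \<open>(s - a x) / (N - 1)\<close>; collecting the terms with
    \<open>a x\<close> turns the first weight into \<open>u\<close>.\<close>
  define u where "u = w 0 - W / of_nat (N - 1)"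
  have N: "N \<ge> 2" "finite A" "A \<noteq> {}" using Suc.prems by (auto simp: N_def)
  hence N1: "of_nat (N - 1) = (of_nat N - 1 :: complex)" "real (N - 1) = real N - 1"
    by (auto simp: of_nat_diff)
  have nz: "(of_nat N - 1 :: complex) \<noteq> 0" "(of_nat N :: complex) \<noteq> 0"
    using N N1(1) by (metis One_nat_def diff_is_0_eq not_less_eq_eq numeral_2_eq_2 of_nat_eq_0_iff, auto)
  have mu: "0 \<le> \<mu>" using Suc.prems(4) N by (meson all_not_in_conv norm_ge_zero order_trans)
  have wsum: "(\<Sum>j<r. cmod (w (Suc j))) \<le> c * (real N - real (Suc r))"
    using Suc.prems(5) norm_ge_zero[of "w 0"] unfolding sum.lessThan_Suc_shift N_def by linarith
  have Wle: "cmod W \<le> c * (real N - 1)"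
  proof -
    have "cmod W \<le> (\<Sum>j<r. cmod (w (Suc j)))" unfolding W_def by (rule norm_sum)
    also have "\<dots> \<le> c * (real N - real (Suc r))" by (rule wsum)
    also have "\<dots> \<le> c * (real N - 1)" using Suc.prems by (intro mult_left_mono) auto
    finally show ?thesis .
  qed
  have u: "cmod u \<le> cmod (w 0) + c"
  proof -
    have "cmod (W / of_nat (N - 1)) = cmod W / (real N - 1)"
      by (simp only: norm_divide norm_of_nat N1(2))
    also have "\<dots> \<le> c" using Wle N by (simp add: divide_le_eq)
    finally show ?thesis
      using norm_triangle_ineq4[of "w 0" "W / of_nat (N - 1)"] unfolding u_def by linarith
  qed
  have rest: "perm_avg (A - {x}) (\<lambda>\<pi>. exp (Re (\<Sum>j<Suc r. w j * a ((x # \<pi>) ! j))))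
      \<le> exp (Re (W * s / of_nat (N - 1)) + V) * exp (Re (u * a x))" if x: "x \<in> A" for x
  proof -
    have card: "card (A - {x}) = N - 1" using x N by (simp add: N_def)
    have s': "(\<Sum>y\<in>A - {x}. a y) = s - a x" using x N by (simp add: s_def sum_diff1)
    have IH: "perm_avg (A - {x}) (\<lambda>\<pi>. exp (Re (\<Sum>j<r. w (Suc j) * a (\<pi> ! j))))
        \<le> exp (Re (W * (s - a x) / of_nat (N - 1)) + V)"
      unfolding V_def W_def s'[symmetric] card[symmetric]
      by (rule Suc.IH) (use Suc.prems x N wsum card N1 in \<open>auto simp: diff_diff_add\<close>)
    have "perm_avg (A - {x}) (\<lambda>\<pi>. exp (Re (\<Sum>j<Suc r. w j * a ((x # \<pi>) ! j))))
        = exp (Re (w 0 * a x)) * perm_avg (A - {x}) (\<lambda>\<pi>. exp (Re (\<Sum>j<r. w (Suc j) * a (\<pi> ! j))))"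
      unfolding sum.lessThan_Suc_shift by (simp add: exp_add perm_avg_cmult del: sum.lessThan_Suc)
    also have "\<dots> \<le> exp (Re (w 0 * a x)) * exp (Re (W * (s - a x) / of_nat (N - 1)) + V)"
      by (intro mult_left_mono IH) auto
    also have "\<dots> = exp (Re (w 0 * a x + W * (s - a x) / of_nat (N - 1)) + V)"
      by (simp add: exp_add)
    also have "w 0 * a x + W * (s - a x) / of_nat (N - 1) = W * s / of_nat (N - 1) + u * a x"
      unfolding u_def by (simp add: algebra_simps diff_divide_distrib)
    finally show ?thesis by (simp add: exp_add mult_ac)
  qed
  have "perm_avg A (\<lambda>\<pi>. exp (Re (\<Sum>j<Suc r. w j * a (\<pi> ! j))))
     \<le> (\<Sum>x\<in>A. exp (Re (W * s / of_nat (N - 1)) + V) * exp (Re (u * a x))) / N"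
    unfolding perm_avg_split_first[OF N(2,3)] N_def[symmetric]
    by (intro divide_right_mono sum_mono rest) auto
  also have "\<dots> = exp (Re (W * s / of_nat (N - 1)) + V) * ((\<Sum>x\<in>A. exp (Re (u * a x))) / card A)"
    by (simp add: sum_distrib_left N_def)
  also have "\<dots> \<le> exp (Re (W * s / of_nat (N - 1)) + V) *
      exp ((\<Sum>x\<in>A. Re (u * a x)) / card A + (cmod u * \<mu>)\<^sup>2 / 2)"
  proof (intro mult_left_mono finite_average_exp_le)
    fix x assume "x \<in> A"
    have "\<bar>Re (u * a x)\<bar> \<le> cmod (u * a x)" by (rule abs_Re_le_cmod)
    also have "\<dots> \<le> cmod u * \<mu>"
      unfolding norm_mult by (intro mult_left_mono Suc.prems \<open>x \<in> A\<close>) auto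
    finally show "\<bar>Re (u * a x)\<bar> \<le> cmod u * \<mu>" .
  qed (use N in auto)
  also have "\<dots> = exp (Re (W * s / of_nat (N - 1)) + V + ((\<Sum>x\<in>A. Re (u * a x)) / card A + (cmod u * \<mu>)\<^sup>2 / 2))"
    by (rule exp_add[symmetric])
  also have "(\<Sum>x\<in>A. Re (u * a x)) / card A = Re (u * s / of_nat N)"
    by (simp only: s_def N_def sum_distrib_left Re_sum Re_divide_of_nat)
  also have "Re (W * s / of_nat (N - 1)) + V + (Re (u * s / of_nat N) + (cmod u * \<mu>)\<^sup>2 / 2)
     = Re ((w 0 + W) * s / of_nat N) + (V + \<mu>\<^sup>2 / 2 * (cmod u)\<^sup>2)"
  proof -
    have "W * s / of_nat (N - 1) + u * s / of_nat N = (w 0 + W) * s / of_nat N"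
    proof -
      have "(w 0 - v) * s + v * s / y = (w 0 + (w 0 - v) * (y - 1)) * s / y" if "y \<noteq> 0" for v y
        using that by (simp add: field_simps)
      from this[of "of_nat N" u] have "(w 0 - u) * s + u * s / of_nat N = (w 0 + (w 0 - u) * (of_nat N - 1)) * s / of_nat N"
        using nz by blast
      moreover have "w 0 - u = W / of_nat (N - 1)" by (simp add: u_def)
      ultimately show ?thesis using nz N1 by simp
    qed
    hence "Re (W * s / of_nat (N - 1)) + Re (u * s / of_nat N) = Re ((w 0 + W) * s / of_nat N)"
      by (simp only: plus_complex.sel[symmetric])
    moreover have "(cmod u * \<mu>)\<^sup>2 / 2 = \<mu>\<^sup>2 / 2 * (cmod u)\<^sup>2" by (simp add: power_mult_distrib)
    ultimately show ?thesis by linarith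
  qed
  also have "exp \<dots> \<le> exp (Re ((w 0 + W) * s / of_nat N) + (V + \<mu>\<^sup>2 / 2 * (cmod (w 0) + c)\<^sup>2))"
    using u by (auto intro!: mult_left_mono power_mono)
  also have "V + \<mu>\<^sup>2 / 2 * (cmod (w 0) + c)\<^sup>2 = \<mu>\<^sup>2 / 2 * (\<Sum>j<Suc r. (cmod (w j) + c)\<^sup>2)"
    unfolding sum.lessThan_Suc_shift V_def by (simp add: algebra_simps)
  also have "w 0 + W = (\<Sum>j<Suc r. w j)"
    unfolding sum.lessThan_Suc_shift W_def by simp
  finally show ?case by (simp only: s_def N_def)
qed


lemma sum_squared_le_card_sum_squares:
  fixes f :: "nat \<Rightarrow> real"
  shows "(\<Sum>j<r. f j)\<^sup>2 \<le> real r * (\<Sum>j<r. (f j)\<^sup>2)"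
  using sum_squared_le_sum_of_squares[of f "{..<r}"] by (simp add: mult.commute)

text \<open>
  A complex number of modulus above \<open>\<surd>2 s\<close> has real part above \<open>s\<close> after multiplication by one of
  \<open>1, -1, \<i>, -\<i>\<close>, which accounts for the factor 4. When at most half of the set is sampled, the
  corrections \<open>c\<close> to the weights cost no more than a factor 4 in the variance term.
\<close>

lemma sampling_without_replacement_tail:
  fixes a :: "'a \<Rightarrow> complex" and w :: "nat \<Rightarrow> complex" and D :: real
  assumes A: "finite A" "A \<noteq> {}" and r: "2 * r \<le> card A"
    and a: "\<And>x. x \<in> A \<Longrightarrow> cmod (a x) \<le> \<mu>"
    and mean: "cmod (\<Sum>x\<in>A. a x) * (\<Sum>j<r. cmod (w j)) \<le> D * card A"
    and t: "0 \<le> t" and s: "0 \<le> s"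
  shows "perm_avg A (\<lambda>\<pi>. of_bool (sqrt 2 * s < cmod (\<Sum>j<r. w j * a (\<pi> ! j))))
       \<le> 4 * exp (2 * t\<^sup>2 * \<mu>\<^sup>2 * (\<Sum>j<r. (cmod (w j))\<^sup>2) + t * D - t * s)"
proof -
  let ?T = "\<lambda>\<pi>. \<Sum>j<r. w j * a (\<pi> ! j)"
  define Q where "Q = (\<Sum>j<r. (cmod (w j))\<^sup>2)"
  define \<sigma> where "\<sigma> = (\<Sum>j<r. cmod (w j))"
  define c where "c = \<sigma> / (real (card A) - real r)"
  have N: "0 < card A" using A by (simp add: card_gt_0_iff)
  hence rN: "r < card A" using r by linarith
  have Nr: "real r \<le> real (card A) - real r" "0 < real (card A) - real r" using r rN by linarith+
  have l0: "0 \<le> \<sigma>" by (simp add: \<sigma>_def sum_nonneg)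
  have c0: "0 \<le> c" unfolding c_def using l0 Nr by simp
  have l2: "\<sigma>\<^sup>2 \<le> real r * Q"
    unfolding \<sigma>_def Q_def by (rule sum_squared_le_card_sum_squares)
  have Q0: "0 \<le> Q" by (simp add: Q_def sum_nonneg)
  have rc: "real r * c\<^sup>2 \<le> Q"
  proof -
    have "real r * \<sigma>\<^sup>2 \<le> real r * (real r * Q)" using l2 by (intro mult_left_mono) auto
    also have "\<dots> = (real r)\<^sup>2 * Q" by (simp add: power2_eq_square)
    also have "\<dots> \<le> (real (card A) - real r)\<^sup>2 * Q"
      using Nr Q0 by (intro mult_right_mono power_mono) auto
    finally show ?thesis using Nr by (simp add: c_def power_divide divide_le_eq mult.commute)
  qed
  have V: "(\<Sum>j<r. (cmod (w j) + c)\<^sup>2) \<le> 4 * Q"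
  proof -
    have "(x + c)\<^sup>2 \<le> 2 * x\<^sup>2 + 2 * c\<^sup>2" for x :: real
      using zero_le_power2[of "x - c"] by (simp add: power2_sum power2_diff)
    hence "(\<Sum>j<r. (cmod (w j) + c)\<^sup>2) \<le> (\<Sum>j<r. 2 * (cmod (w j))\<^sup>2 + 2 * c\<^sup>2)"
      by (intro sum_mono)
    also have "\<dots> = 2 * Q + 2 * (real r * c\<^sup>2)"
      by (simp add: Q_def sum.distrib sum_distrib_left)
    finally show ?thesis using rc by linarith
  qed
  have direction: "perm_avg A (\<lambda>\<pi>. exp (t * Re (d * ?T \<pi>))) \<le> exp (2 * t\<^sup>2 * \<mu>\<^sup>2 * Q + t * D)"
    if d: "cmod d = 1" for d
  proof -
    let ?w = "\<lambda>j. complex_of_real t * d * w j"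
    have norm_w: "cmod (?w j) = t * cmod (w j)" for j using t d by (simp add: norm_mult)
    have "perm_avg A (\<lambda>\<pi>. exp (Re (\<Sum>j<r. ?w j * a (\<pi> ! j))))
       \<le> exp (Re ((\<Sum>j<r. ?w j) * (\<Sum>x\<in>A. a x) / of_nat (card A)) +
              \<mu>\<^sup>2 / 2 * (\<Sum>j<r. (cmod (?w j) + t * c)\<^sup>2))"
    proof (rule sampling_without_replacement_mgf[OF A(1) rN _ a])
      show "(\<Sum>j<r. cmod (?w j)) \<le> t * c * (real (card A) - real r)"
        unfolding norm_w c_def using Nr by (simp add: \<sigma>_def sum_distrib_left)
    qed (use t c0 in auto)
    also have "(\<Sum>j<r. (cmod (?w j) + t * c)\<^sup>2) = t\<^sup>2 * (\<Sum>j<r. (cmod (w j) + c)\<^sup>2)"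
      unfolding norm_w by (simp add: sum_distrib_left power_mult_distrib flip: distrib_left)
    also have "(\<lambda>\<pi>. exp (Re (\<Sum>j<r. ?w j * a (\<pi> ! j)))) = (\<lambda>\<pi>. exp (t * Re (d * ?T \<pi>)))"
    proof
      fix \<pi>
      have scale: "Re (complex_of_real t * y) = t * Re y" for y by simp
      have "(\<Sum>j<r. ?w j * a (\<pi> ! j)) = complex_of_real t * (d * ?T \<pi>)"
        by (simp add: sum_distrib_left mult_ac)
      thus "exp (Re (\<Sum>j<r. ?w j * a (\<pi> ! j))) = exp (t * Re (d * ?T \<pi>))"
        using scale by (simp only:)
    qed
    also have "exp (Re ((\<Sum>j<r. ?w j) * (\<Sum>x\<in>A. a x) / of_nat (card A)) +
              \<mu>\<^sup>2 / 2 * (t\<^sup>2 * (\<Sum>j<r. (cmod (w j) + c)\<^sup>2))) \<le> exp (t * D + 2 * t\<^sup>2 * \<mu>\<^sup>2 * Q)"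
    proof -
      have "Re ((\<Sum>j<r. ?w j) * (\<Sum>x\<in>A. a x) / of_nat (card A))
          \<le> cmod ((\<Sum>j<r. ?w j) * (\<Sum>x\<in>A. a x) / of_nat (card A))" by (rule complex_Re_le_cmod)
      also have "\<dots> = cmod (\<Sum>j<r. ?w j) * cmod (\<Sum>x\<in>A. a x) / card A"
        by (simp add: norm_mult norm_divide)
      also have "\<dots> \<le> (t * \<sigma>) * cmod (\<Sum>x\<in>A. a x) / card A"
      proof (intro divide_right_mono mult_right_mono)
        have "cmod (\<Sum>j<r. ?w j) \<le> (\<Sum>j<r. cmod (?w j))" by (rule norm_sum)
        thus "cmod (\<Sum>j<r. ?w j) \<le> t * \<sigma>" unfolding norm_w by (simp add: \<sigma>_def sum_distrib_left)
      qed auto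
      also have "\<dots> = t * ((cmod (\<Sum>x\<in>A. a x) * \<sigma>) / card A)" by simp
      also have "\<dots> \<le> t * D"
        using mean N t unfolding \<sigma>_def by (intro mult_left_mono) (auto simp: divide_le_eq)
      finally have 1: "Re ((\<Sum>j<r. ?w j) * (\<Sum>x\<in>A. a x) / of_nat (card A)) \<le> t * D" .
      have "\<mu>\<^sup>2 / 2 * (t\<^sup>2 * (\<Sum>j<r. (cmod (w j) + c)\<^sup>2)) \<le> \<mu>\<^sup>2 / 2 * (t\<^sup>2 * (4 * Q))"
        by (intro mult_left_mono V) auto
      hence "\<mu>\<^sup>2 / 2 * (t\<^sup>2 * (\<Sum>j<r. (cmod (w j) + c)\<^sup>2)) \<le> 2 * t\<^sup>2 * \<mu>\<^sup>2 * Q"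
        by (simp add: mult_ac)
      with 1 show ?thesis unfolding exp_le_cancel_iff by (rule add_mono)
    qed
    finally show ?thesis by (simp add: add.commute)
  qed
  let ?E = "\<lambda>d \<pi>. exp (- (t * s)) * exp (t * Re (d * ?T \<pi>))"
  have "of_bool (sqrt 2 * s < cmod (?T \<pi>)) \<le> (?E 1 \<pi> + ?E (-1) \<pi>) + (?E \<i> \<pi> + ?E (-\<i>) \<pi>)" for \<pi>
  proof (cases "sqrt 2 * s < cmod (?T \<pi>)")
    case True
    have nonneg: "0 \<le> ?E d \<pi>" for d by simp
    have "s < Re (1 * ?T \<pi>) \<or> s < Re (-1 * ?T \<pi>) \<or> s < Re (\<i> * ?T \<pi>) \<or> s < Re (-\<i> * ?T \<pi>)"
    proof (rule ccontr)
      assume "\<not> ?thesis"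
      hence "\<bar>Re (?T \<pi>)\<bar> \<le> s" "\<bar>Im (?T \<pi>)\<bar> \<le> s" by auto
      moreover have "(cmod y)\<^sup>2 \<le> (sqrt 2 * s)\<^sup>2" if "\<bar>Re y\<bar> \<le> s" "\<bar>Im y\<bar> \<le> s" for y
        using power_mono[OF that(1), of 2] power_mono[OF that(2), of 2]
        by (simp add: cmod_power2 power_mult_distrib)
      ultimately have "(cmod (?T \<pi>))\<^sup>2 \<le> (sqrt 2 * s)\<^sup>2" by blast
      hence "cmod (?T \<pi>) \<le> sqrt 2 * s" by (rule power2_le_imp_le) (use s in simp)
      with True show False by simp
    qed
    moreover have "1 \<le> ?E d \<pi>" if "s < Re (d * ?T \<pi>)" for d
    proof -
      have "t * s \<le> t * Re (d * ?T \<pi>)" using that t by (intro mult_left_mono) auto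
      thus ?thesis by (simp flip: exp_add)
    qed
    ultimately have "1 \<le> ?E 1 \<pi> \<or> 1 \<le> ?E (-1) \<pi> \<or> 1 \<le> ?E \<i> \<pi> \<or> 1 \<le> ?E (-\<i>) \<pi>"
      by blast
    hence "1 \<le> (?E 1 \<pi> + ?E (-1) \<pi>) + (?E \<i> \<pi> + ?E (-\<i>) \<pi>)"
      using nonneg[of 1] nonneg[of "-1"] nonneg[of "\<i>"] nonneg[of "-\<i>"] by linarith
    thus ?thesis using True by (simp only: of_bool_eq)
  qed simp
  hence "perm_avg A (\<lambda>\<pi>. of_bool (sqrt 2 * s < cmod (?T \<pi>)))
     \<le> perm_avg A (\<lambda>\<pi>. (?E 1 \<pi> + ?E (-1) \<pi>) + (?E \<i> \<pi> + ?E (-\<i>) \<pi>))"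
    by (intro perm_avg_mono)
  also have "\<dots> \<le> (exp (- (t * s)) * exp (2 * t\<^sup>2 * \<mu>\<^sup>2 * Q + t * D)
        + exp (- (t * s)) * exp (2 * t\<^sup>2 * \<mu>\<^sup>2 * Q + t * D))
      + (exp (- (t * s)) * exp (2 * t\<^sup>2 * \<mu>\<^sup>2 * Q + t * D)
        + exp (- (t * s)) * exp (2 * t\<^sup>2 * \<mu>\<^sup>2 * Q + t * D))"
    unfolding perm_avg_add perm_avg_cmult
    by (intro add_mono mult_left_mono direction) auto
  also have "\<dots> = 4 * exp (2 * t\<^sup>2 * \<mu>\<^sup>2 * Q + t * D - t * s)"
    by (simp add: exp_diff exp_minus field_simps)
  finally show ?thesis unfolding Q_def .
qed

section \<open>The Hermitian inner product and the spectral norm\<close>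

lemma hinner_add_left: "hinner (u + v) w = hinner u w + hinner v w"
  by (simp add: hinner_def algebra_simps sum.distrib)

lemma hinner_add_right: "hinner u (v + w) = hinner u v + hinner u w"
  by (simp add: hinner_def algebra_simps sum.distrib)

lemma hinner_diff_left: "hinner (u - v) w = hinner u w - hinner v w"
  by (simp add: hinner_def algebra_simps sum_subtractf)

lemma hinner_diff_right: "hinner u (v - w) = hinner u v - hinner u w"
  by (simp add: hinner_def algebra_simps sum_subtractf)

lemma hinner_scale_left: "hinner (c *s u) v = cnj c * hinner u v"
  by (simp add: hinner_def sum_distrib_left mult_ac)

lemma hinner_scale_right: "hinner u (c *s v) = c * hinner u v"
  by (simp add: hinner_def sum_distrib_left mult_ac)

lemma hinner_0_left [simp]: "hinner 0 v = 0"
  by (simp add: hinner_def)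

lemma hinner_0_right [simp]: "hinner v 0 = 0"
  by (simp add: hinner_def)

lemma cnj_hinner: "cnj (hinner u v) = hinner v u"
  by (simp add: hinner_def mult.commute)

lemma hinner_sum_left: "hinner (sum f A) v = (\<Sum>a\<in>A. hinner (f a) v)"
  by (induction A rule: infinite_finite_induct) (auto simp: hinner_add_left)

lemma hinner_sum_right: "hinner v (sum f A) = (\<Sum>a\<in>A. hinner v (f a))"
  by (induction A rule: infinite_finite_induct) (auto simp: hinner_add_right)

lemma norm_vec_squared: "(norm (u :: complex ^ 'n))\<^sup>2 = (\<Sum>i\<in>UNIV. (cmod (u $ i))\<^sup>2)"
  by (simp add: norm_vec_def L2_set_def sum_nonneg)

lemma hinner_self: "hinner u u = complex_of_real ((norm u)\<^sup>2)"
  unfolding norm_vec_squared hinner_def of_real_sum complex_norm_square by (simp add: mult.commute)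

lemma cmod_hinner_le: "cmod (hinner u v) \<le> norm u * norm v"
proof -
  have "cmod (hinner u v) \<le> (\<Sum>i\<in>UNIV. \<bar>cmod (u $ i)\<bar> * \<bar>cmod (v $ i)\<bar>)"
    unfolding hinner_def by (rule order_trans[OF norm_sum]) (simp add: norm_mult)
  also have "\<dots> \<le> norm u * norm v"
    unfolding norm_vec_def by (rule L2_set_mult_ineq)
  finally show ?thesis .
qed

lemma matrix_vector_mult_sum_columns:
  fixes X :: "complex ^ 'p ^ 'n"
  shows "X *v b = (\<Sum>j\<in>UNIV. b $ j *s column j X)"
  by (rule matrix_mult_sum)

text \<open>
  This says that \<open>X\<^sup>H\<close> has operator norm at most \<open>\<parallel>X\<parallel>\<close>: with \<open>g = X\<^sup>H w\<close> one has
  \<open>\<parallel>g\<parallel>\<^sup>2 = \<langle>X g, w\<rangle> \<le> \<parallel>X\<parallel> \<parallel>g\<parallel> \<parallel>w\<parallel>\<close>.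
\<close>

lemma sum_hinner_columns_squared_le:
  fixes X :: "complex ^ 'p ^ 'n"
  shows "(\<Sum>j\<in>UNIV. (cmod (hinner (column j X) w))\<^sup>2) \<le> (spectral_norm X)\<^sup>2 * (norm w)\<^sup>2"
proof -
  define g where "g = hermitian_transpose X *v w"
  have g: "g $ j = hinner (column j X) w" for j
    by (simp add: g_def hermitian_transpose_def matrix_vector_mult_def hinner_def column_def)
  have "hinner (X *v g) w = (\<Sum>j\<in>UNIV. cnj (g $ j) * g $ j)"
    unfolding matrix_vector_mult_sum_columns hinner_sum_left hinner_scale_left g ..
  hence "hinner (X *v g) w = complex_of_real ((norm g)\<^sup>2)"
    by (simp only: hinner_self[symmetric] hinner_def[of g g])
  hence "(norm g)\<^sup>2 = cmod (hinner (X *v g) w)" by (simp del: of_real_power)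
  also have "\<dots> \<le> norm (X *v g) * norm w" by (rule cmod_hinner_le)
  also have "\<dots> \<le> spectral_norm X * norm g * norm w"
    unfolding spectral_norm_def
    by (intro mult_right_mono onorm matrix_vector_mul_bounded_linear) auto
  finally have le: "norm g * norm g \<le> norm g * (spectral_norm X * norm w)"
    by (simp add: power2_eq_square mult_ac)
  have "norm g \<le> spectral_norm X * norm w"
  proof (cases "g = 0")
    case True
    thus ?thesis unfolding spectral_norm_def
      by (simp add: onorm_pos_le matrix_vector_mul_bounded_linear)
  qed (use le in simp)
  hence "(norm g)\<^sup>2 \<le> (spectral_norm X * norm w)\<^sup>2" by (intro power_mono) auto
  thus ?thesis by (simp add: norm_vec_squared[of g] g power_mult_distrib)
qed

section \<open>Residuals after projection to a set of columns\<close>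

definition columns_independent :: "complex ^ 'p ^ 'n \<Rightarrow> 'p set \<Rightarrow> bool" where
  "columns_independent X V \<longleftrightarrow> (\<forall>c. (\<Sum>v\<in>V. c v *s column v X) = 0 \<longrightarrow> (\<forall>v\<in>V. c v = 0))"

text \<open>
  \<open>R\<close> is the orthogonal projection to the complement of the complex span of the columns in \<open>V\<close>. The
  two clauses determine \<open>R\<close>; linearity, idempotence and self-adjointness are available through
  \<open>hinner_residual_map_left\<close> and \<open>hinner_residual_map_right\<close>.
\<close>

definition residual_map :: "complex ^ 'p ^ 'n \<Rightarrow> 'p set \<Rightarrow> (complex ^ 'n \<Rightarrow> complex ^ 'n) \<Rightarrow> bool" where
  "residual_map X V R \<longleftrightarrow>
     (\<forall>x. \<exists>c. x - R x = (\<Sum>v\<in>V. c v *s column v X)) \<and>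
     (\<forall>x. \<forall>v\<in>V. hinner (column v X) (R x) = 0)"

lemma residual_map_orthogonal:
  "residual_map X V R \<Longrightarrow> v \<in> V \<Longrightarrow> hinner (column v X) (R x) = 0"
  by (simp add: residual_map_def)

lemma hinner_residual_map_left:
  assumes "residual_map X V R"
  shows "hinner (R x) (R y) = hinner x (R y)"
proof -
  obtain c where c: "x - R x = (\<Sum>v\<in>V. c v *s column v X)"
    using assms unfolding residual_map_def by blast
  have "hinner (x - R x) (R y) = 0"
    unfolding c hinner_sum_left hinner_scale_left
    by (simp add: residual_map_orthogonal[OF assms])
  thus ?thesis by (simp add: hinner_diff_left)
qed

lemma hinner_residual_map_right:
  assumes "residual_map X V R"
  shows "hinner (R x) (R y) = hinner (R x) y"
  by (metis assms cnj_hinner hinner_residual_map_left)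

lemma norm_diff_residual_map:
  assumes "residual_map X V R"
  shows "(norm (x - R x))\<^sup>2 = (norm x)\<^sup>2 - (norm (R x))\<^sup>2"
proof -
  have "hinner (x - R x) (x - R x) = hinner x x - hinner (R x) (R x)"
    using hinner_residual_map_left[OF assms, of x x] hinner_residual_map_right[OF assms, of x x]
    by (simp add: hinner_diff_left hinner_diff_right)
  thus ?thesis unfolding hinner_self by (metis of_real_diff of_real_eq_iff)
qed

lemma norm_residual_map_le:
  assumes "residual_map X V R"
  shows "norm (R x) \<le> norm x"
proof -
  have "(norm (R x))\<^sup>2 \<le> (norm x)\<^sup>2"
    using norm_diff_residual_map[OF assms, of x] zero_le_power2[of "norm (x - R x)"] by linarith
  thus ?thesis by (rule power2_le_imp_le) simp
qed

lemma residual_map_empty: "residual_map X {} (\<lambda>x. x)"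
  by (simp add: residual_map_def)

text \<open>
  One Gram-Schmidt step. The norm formula is the rank-one update that drives the random argument.
\<close>

lemma residual_map_insert:
  fixes X :: "complex ^ 'p ^ 'n"
  assumes R: "residual_map X V R" and u: "u \<notin> V"
    and r: "r = R (column u X)" "r \<noteq> 0"
    and R': "R' = (\<lambda>x. R x - (hinner r (R x) / hinner r r) *s r)"
  shows "residual_map X (insert u V) R'"
    and "(norm (R' x))\<^sup>2 = (norm (R x))\<^sup>2 - (cmod (hinner r x))\<^sup>2 / (norm r)\<^sup>2"
proof -
  have nz: "hinner r r \<noteq> 0" using r(2) by (simp add: hinner_self)
  show *: "residual_map X (insert u V) R'"
    unfolding residual_map_def
  proof (intro conjI allI ballI)
    fix x
    define \<alpha> where "\<alpha> = hinner r (R x) / hinner r r"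
    obtain c where c: "x - R x = (\<Sum>v\<in>V. c v *s column v X)"
      using R unfolding residual_map_def by blast
    obtain d where d: "column u X - r = (\<Sum>v\<in>V. d v *s column v X)"
      using R unfolding residual_map_def r(1) by blast
    let ?c = "(\<lambda>v. c v - \<alpha> * d v)(u := \<alpha>)"
    have "(\<Sum>v\<in>insert u V. ?c v *s column v X)
        = \<alpha> *s column u X + (\<Sum>v\<in>V. (c v - \<alpha> * d v) *s column v X)"
      using u by (subst sum.insert) (auto intro!: sum.cong)
    also have "(\<Sum>v\<in>V. (c v - \<alpha> * d v) *s column v X) = (x - R x) - \<alpha> *s (column u X - r)"
      unfolding c d by (simp add: vec.scale_sum_right vec.scale_left_diff_distrib sum_subtractf)
    also have "\<alpha> *s column u X + (x - R x - \<alpha> *s (column u X - r)) = x - R' x"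
      by (simp add: R' \<alpha>_def algebra_simps vec.scale_right_diff_distrib)
    finally show "\<exists>c. x - R' x = (\<Sum>v\<in>insert u V. c v *s column v X)" by metis
  next
    fix x v assume v: "v \<in> insert u V"
    show "hinner (column v X) (R' x) = 0"
    proof (cases "v = u")
      case True
      have "hinner (column u X) (R x) = hinner r (R x)"
        unfolding r(1) by (rule hinner_residual_map_left[OF R, symmetric])
      moreover have "hinner (column u X) r = hinner r r"
        unfolding r(1) by (rule hinner_residual_map_left[OF R, symmetric])
      ultimately show ?thesis
        using True nz by (simp add: R' hinner_diff_right hinner_scale_right)
    next
      case False
      hence "v \<in> V" using v by simp
      thus ?thesis
        using residual_map_orthogonal[OF R] by (simp add: R' r(1) hinner_diff_right hinner_scale_right)
    qed
  qed
  have rx: "hinner r (R x) = hinner r x"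
    unfolding r(1) by (rule hinner_residual_map_right[OF R])
  have "hinner (R' x) (R' x) = hinner (R' x) x"
    by (rule hinner_residual_map_right[OF *])
  also have "\<dots> = hinner (R x) x - cnj (hinner r x) / hinner r r * hinner r x"
    by (simp add: R' hinner_diff_left hinner_scale_left rx cnj_hinner)
  also have "cnj (hinner r x) / hinner r r * hinner r x
      = complex_of_real ((cmod (hinner r x))\<^sup>2 / (norm r)\<^sup>2)"
    unfolding hinner_self of_real_divide complex_norm_square[of "hinner r x"] by (simp add: mult.commute)
  also have "hinner (R x) x = hinner (R x) (R x)"
    by (rule hinner_residual_map_right[OF R, symmetric])
  finally show "(norm (R' x))\<^sup>2 = (norm (R x))\<^sup>2 - (cmod (hinner r x))\<^sup>2 / (norm r)\<^sup>2"
    unfolding hinner_self by (metis of_real_diff of_real_eq_iff)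
qed

text \<open>
  Pairing a linear relation with the residual of the new column isolates the new coefficient.
\<close>

lemma columns_independent_insert:
  assumes R: "residual_map X V R" and "u \<notin> V" and "R (column u X) \<noteq> 0"
    and V: "columns_independent X V"
  shows "columns_independent X (insert u V)"
  unfolding columns_independent_def
proof (intro allI impI)
  fix c assume "(\<Sum>v\<in>insert u V. c v *s column v X) = 0"
  hence 0: "c u *s column u X + (\<Sum>v\<in>V. c v *s column v X) = 0"
    using \<open>u \<notin> V\<close> by (subst (asm) sum.insert) auto
  let ?r = "R (column u X)"
  have "hinner ?r (c u *s column u X + (\<Sum>v\<in>V. c v *s column v X)) = c u * hinner ?r (column u X)"
    using residual_map_orthogonal[OF R] cnj_hinner[of _ ?r]
    by (simp add: hinner_add_right hinner_sum_right hinner_scale_right)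
       (metis (no_types, lifting) complex_cnj_zero mult_zero_right sum.neutral cnj_hinner)
  also have "hinner ?r (column u X) = hinner ?r ?r"
    by (rule hinner_residual_map_right[OF R, symmetric])
  finally have "c u = 0" using assms(3) by (simp add: 0 hinner_self)
  moreover from this 0 have "\<forall>v\<in>V. c v = 0"
    using V unfolding columns_independent_def by auto
  ultimately show "\<forall>v\<in>insert u V. c v = 0" by simp
qed

lemma residual_map_exists:
  fixes X :: "complex ^ 'p ^ 'n"
  assumes "finite V"
  shows "\<exists>R. residual_map X V R"
  using assms
proof (induction V)
  case empty
  show ?case using residual_map_empty by blast
next
  case (insert u V)
  then obtain R where R: "residual_map X V R" by blast
  show ?case
  proof (cases "R (column u X) = 0")
    case False
    show ?thesis using residual_map_insert(1)[OF R insert.hyps(2) refl False refl] by blast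
  next
    case True
    have "hinner (column u X) (R x) = 0" for x
      using hinner_residual_map_left[OF R, of "column u X" x] True by simp
    moreover have "\<exists>c. x - R x = (\<Sum>v\<in>insert u V. c v *s column v X)" for x
    proof -
      obtain c where c: "x - R x = (\<Sum>v\<in>V. c v *s column v X)"
        using R unfolding residual_map_def by blast
      also have "\<dots> = (\<Sum>v\<in>insert u V. (c(u := 0)) v *s column v X)"
        using insert.hyps by (subst sum.insert) (auto intro!: sum.cong)
      finally show ?thesis by blast
    qed
    ultimately have "residual_map X (insert u V) R"
      using R unfolding residual_map_def by auto
    thus ?thesis by blast
  qed
qed

text \<open>
  The dual vector is the residual of \<open>column c X\<close> with respect to the other columns, rescaled. That it
  lies in the span of the columns makes the product of matrix and pseudoinverse Hermitian later on.
\<close>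

lemma columns_independent_dual_vector:
  fixes X :: "complex ^ 'p ^ 'n"
  assumes V: "columns_independent X V" and c: "c \<in> V"
  shows "\<exists>g \<alpha>. g = (\<Sum>d\<in>V. \<alpha> d *s column d X) \<and>
                (\<forall>d\<in>V. hinner g (column d X) = (if d = c then 1 else 0))"
proof -
  obtain R where R: "residual_map X (V - {c}) R"
    using residual_map_exists[of "V - {c}" X] by auto
  let ?r = "R (column c X)"
  obtain \<beta> where \<beta>: "column c X - ?r = (\<Sum>v\<in>V - {c}. \<beta> v *s column v X)"
    using R unfolding residual_map_def by blast
  have span: "?r = (\<Sum>d\<in>V. ((\<lambda>d. - \<beta> d)(c := 1)) d *s column d X)" (is "_ = (\<Sum>d\<in>V. ?\<gamma> d *s _)")
  proof -
    have "(\<Sum>d\<in>V. ?\<gamma> d *s column d X) = column c X + (\<Sum>d\<in>V - {c}. ?\<gamma> d *s column d X)"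
      using c by (subst sum.remove[of _ c]) auto
    also have "(\<Sum>d\<in>V - {c}. ?\<gamma> d *s column d X) = - (\<Sum>d\<in>V - {c}. \<beta> d *s column d X)"
      unfolding sum_negf[symmetric] by (intro sum.cong) (auto simp: vec.scale_minus_left)
    finally show ?thesis unfolding \<beta>[symmetric] by simp
  qed
  have nz: "?r \<noteq> 0"
  proof
    assume "?r = 0"
    with span V have "?\<gamma> c = 0" unfolding columns_independent_def using c by metis
    thus False by simp
  qed
  have dual: "hinner ?r (column d X) = (if d = c then hinner ?r ?r else 0)" if "d \<in> V" for d
  proof (cases "d = c")
    case True
    thus ?thesis by (simp add: hinner_residual_map_right[OF R])
  next
    case False
    thus ?thesis using that residual_map_orthogonal[OF R, of d] cnj_hinner[of "column d X" ?r]
      by auto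
  qed
  define \<rho> where "\<rho> = complex_of_real (1 / (norm ?r)\<^sup>2)"
  have "\<rho> *s ?r = (\<Sum>d\<in>V. (\<rho> * ?\<gamma> d) *s column d X)"
    by (subst span) (simp add: vec.scale_sum_right)
  moreover have "hinner (\<rho> *s ?r) (column d X) = (if d = c then 1 else 0)" if "d \<in> V" for d
    using dual[OF that] nz by (simp add: hinner_scale_left hinner_self \<rho>_def)
  ultimately show ?thesis
    by (intro exI[of _ "\<rho> *s ?r"] exI[of _ "\<lambda>d. \<rho> * ?\<gamma> d"] conjI ballI)
qed

section \<open>Independence of randomly chosen columns\<close>

lemma exp_le_chord:
  fixes d b \<theta> :: real
  assumes "0 \<le> d" "d \<le> b" "0 < b"
  shows "exp (\<theta> * d) \<le> 1 + d * ((exp (\<theta> * b) - 1) / b)"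
proof -
  have "convex_on UNIV (\<lambda>x::real. exp x)" by (rule exp_convex)
  from convex_onD[OF this, of "d / b" 0 "\<theta> * b"]
  have "exp (d / b * (\<theta> * b)) \<le> (1 - d / b) * exp 0 + d / b * exp (\<theta> * b)"
    using assms by (simp add: divide_le_eq)
  moreover have "d / b * (\<theta> * b) = \<theta> * d" using assms by simp
  moreover have "(1 - d / b) * exp 0 + d / b * exp (\<theta> * b) = 1 + d * ((exp (\<theta> * b) - 1) / b)"
    by (simp add: algebra_simps diff_divide_distrib)
  ultimately show ?thesis by simp
qed

text \<open>
  The state is the set \<open>- A\<close> of revealed columns, with residual map \<open>R\<close>; the projection of \<open>x\<^sub>i\<close> to
  their span has squared norm \<open>1 - \<parallel>R x\<^sub>i\<parallel>\<^sup>2\<close>. The right-hand side is an exponential supermartingale. In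
  a state where some projection exceeds \<open>\<kappa>\<close> it is at least 1, so nothing is left to prove; in all other
  states no unrevealed column is in the span, every increment is at most \<open>b\<close> by incoherence, and the
  increments summed over the next column are bounded through the spectral norm. The parameter \<open>m\<close> is a
  lower bound for the number of columns not yet revealed, and \<open>g\<close> the relative growth per step.
\<close>

lemma random_columns_dependent_le:
  fixes X :: "complex ^ 'p ^ 'n"
  assumes unit: "\<And>j. norm (column j X) = 1"
    and coh: "\<And>i j. i \<noteq> j \<Longrightarrow> cmod (hinner (column i X) (column j X)) \<le> \<mu>"
    and \<kappa>: "0 < \<kappa>" "\<kappa> < 1" and \<mu>: "0 \<le> \<mu>" and \<theta>: "0 \<le> \<theta>" and m: "0 < m"
    and b: "(\<mu> + \<kappa>)\<^sup>2 / (1 - \<kappa>) \<le> b"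
  defines "g \<equiv> (spectral_norm X)\<^sup>2 * ((exp (\<theta> * b) - 1) / b) / ((1 - \<kappa>) * m)"
  shows "residual_map X (- A) R \<Longrightarrow> columns_independent X (- A) \<Longrightarrow> m + real r \<le> card A \<Longrightarrow>
     perm_avg A (\<lambda>\<pi>. of_bool (\<not> columns_independent X (- A \<union> set (take r \<pi>))))
       \<le> exp (- (\<theta> * \<kappa>)) * (1 + g) ^ r * (\<Sum>i\<in>A. exp (\<theta> * (1 - (norm (R (column i X)))\<^sup>2)))"
proof (induction r arbitrary: A R)
  case 0
  thus ?case by (simp add: perm_avg_def sum_nonneg)
next
  case (Suc r)
  note R = Suc.prems(1)
  define q where "q i = 1 - (norm (R (column i X)))\<^sup>2" for i
  define G where "G = (exp (\<theta> * b) - 1) / b"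
  have b0: "0 < b"
  proof -
    have "0 < (\<mu> + \<kappa>)\<^sup>2 / (1 - \<kappa>)" using \<kappa> \<mu> by (intro divide_pos_pos) auto
    thus ?thesis using b by linarith
  qed
  have G0: "0 \<le> G" unfolding G_def using b0 \<theta> by simp
  have g0: "0 \<le> g" unfolding g_def G_def[symmetric] using \<kappa> m G0 by simp
  have A: "finite A" "A \<noteq> {}" and mA: "m \<le> card A" using Suc.prems(3) m by (auto simp: finite_subset)
  have nonneg: "0 \<le> q i" for i
    using norm_residual_map_le[OF R, of "column i X"] unit[of i]
    by (simp add: q_def power_le_one)
  show ?case
  proof (cases "\<exists>i\<in>A. \<kappa> < q i")
    case True
    then obtain i where i: "i \<in> A" "\<kappa> < q i" by blast
    have "perm_avg A (\<lambda>\<pi>. of_bool (\<not> columns_independent X (- A \<union> set (take (Suc r) \<pi>)))) \<le> perm_avg A (\<lambda>_. 1)"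
      by (intro perm_avg_mono) auto
    also have "\<dots> = exp (- (\<theta> * \<kappa>)) * 1 * exp (\<theta> * \<kappa>)"
      using A by (simp add: perm_avg_const exp_minus)
    also have "\<dots> \<le> exp (- (\<theta> * \<kappa>)) * (1 + g) ^ Suc r * (\<Sum>i\<in>A. exp (\<theta> * q i))"
    proof (intro mult_mono mult_left_mono)
      show "1 \<le> (1 + g) ^ Suc r" using g0 by (intro one_le_power) auto
      have "exp (\<theta> * \<kappa>) \<le> exp (\<theta> * q i)" using i \<theta> by (simp add: mult_left_mono)
      also have "\<dots> \<le> (\<Sum>i\<in>A. exp (\<theta> * q i))"
        using A(1) i(1) by (intro member_le_sum) auto
      finally show "exp (\<theta> * \<kappa>) \<le> (\<Sum>i\<in>A. exp (\<theta> * q i))" .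
    qed (use g0 in auto)
    finally show ?thesis unfolding q_def .
  next
    case False
    have card_A: "0 < card A" using A by (simp add: card_gt_0_iff)
    from False have small: "q i \<le> \<kappa>" if "i \<in> A" for i using that by force
    define d where "d u i = (cmod (hinner (R (column u X)) (column i X)))\<^sup>2 / (norm (R (column u X)))\<^sup>2" for u i
    have norm_R: "1 - \<kappa> \<le> (norm (R (column i X)))\<^sup>2" if "i \<in> A" for i
      using small[OF that] by (simp add: q_def)
    have R_nz: "R (column i X) \<noteq> 0" if "i \<in> A" for i
      using norm_R[OF that] \<kappa> by auto
    have d0: "0 \<le> d u i" for u i by (simp add: d_def)
    \<comment> \<open>\<open>d u i\<close> is the increase of \<open>q i\<close> caused by revealing \<open>u\<close>. Its numerator is the inner product of the
      columns minus the inner product of their projections to the span, whose norms are at most \<open>\<surd>\<kappa>\<close>.\<close>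
    have d_le: "d u i \<le> b" if "u \<in> A" "i \<in> A" "u \<noteq> i" for u i
    proof -
      let ?x = "column u X" and ?y = "column i X"
      have "hinner (R ?x) ?y = hinner ?x ?y - hinner (?x - R ?x) (?y - R ?y)"
        using hinner_residual_map_left[OF R, of ?x ?y] hinner_residual_map_right[OF R, of ?x ?y]
        by (simp add: hinner_diff_left hinner_diff_right)
      hence "cmod (hinner (R ?x) ?y) \<le> cmod (hinner ?x ?y) + cmod (hinner (?x - R ?x) (?y - R ?y))"
        by (simp add: norm_triangle_ineq4)
      also have "cmod (hinner (?x - R ?x) (?y - R ?y)) \<le> norm (?x - R ?x) * norm (?y - R ?y)"
        by (rule cmod_hinner_le)
      also have "\<dots> \<le> sqrt \<kappa> * sqrt \<kappa>"
      proof (intro mult_mono)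
        show "norm (?x - R ?x) \<le> sqrt \<kappa>"
          using norm_diff_residual_map[OF R, of ?x] small[OF that(1)] unit[of u]
          by (intro real_le_rsqrt) (simp add: q_def)
        show "norm (?y - R ?y) \<le> sqrt \<kappa>"
          using norm_diff_residual_map[OF R, of ?y] small[OF that(2)] unit[of i]
          by (intro real_le_rsqrt) (simp add: q_def)
      qed (use \<kappa> in auto)
      also have "sqrt \<kappa> * sqrt \<kappa> = \<kappa>" using \<kappa> by simp
      also have "cmod (hinner ?x ?y) \<le> \<mu>" by (rule coh) fact
      finally have "cmod (hinner (R ?x) ?y) \<le> \<mu> + \<kappa>" by simp
      hence "d u i \<le> (\<mu> + \<kappa>)\<^sup>2 / (1 - \<kappa>)"
        unfolding d_def using norm_R[OF that(1)] \<kappa> by (intro frac_le power_mono) auto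
      thus ?thesis using b by linarith
    qed
    have sum_d: "(\<Sum>u\<in>A. d u i) \<le> (spectral_norm X)\<^sup>2 / (1 - \<kappa>)" if "i \<in> A" for i
    proof -
      have "(\<Sum>u\<in>A. d u i) \<le> (\<Sum>u\<in>A. (cmod (hinner (column u X) (R (column i X))))\<^sup>2 / (1 - \<kappa>))"
      proof (rule sum_mono)
        fix u assume "u \<in> A"
        have "hinner (R (column u X)) (column i X) = hinner (column u X) (R (column i X))"
          using hinner_residual_map_left[OF R] hinner_residual_map_right[OF R] by metis
        thus "d u i \<le> (cmod (hinner (column u X) (R (column i X))))\<^sup>2 / (1 - \<kappa>)"
          unfolding d_def using norm_R[OF \<open>u \<in> A\<close>] \<kappa> by (intro frac_le) auto
      qed
      also have "\<dots> = (\<Sum>u\<in>A. (cmod (hinner (column u X) (R (column i X))))\<^sup>2) / (1 - \<kappa>)"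
        by (simp add: sum_divide_distrib)
      also have "\<dots> \<le> (\<Sum>u\<in>UNIV. (cmod (hinner (column u X) (R (column i X))))\<^sup>2) / (1 - \<kappa>)"
        using \<kappa> by (intro divide_right_mono sum_mono2) auto
      also have "\<dots> \<le> ((spectral_norm X)\<^sup>2 * (norm (R (column i X)))\<^sup>2) / (1 - \<kappa>)"
        using \<kappa> by (intro divide_right_mono sum_hinner_columns_squared_le) auto
      also have "\<dots> \<le> ((spectral_norm X)\<^sup>2 * 1) / (1 - \<kappa>)"
        using \<kappa> nonneg[of i] by (intro divide_right_mono mult_left_mono) (auto simp: q_def)
      finally show ?thesis by simp
    qed
    let ?C = "exp (- (\<theta> * \<kappa>)) * (1 + g) ^ r"
    have C0: "0 \<le> ?C" using g0 by simp
    have step: "perm_avg (A - {u}) (\<lambda>\<pi>. of_bool (\<not> columns_independent X (- A \<union> set (take (Suc r) (u # \<pi>)))))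
        \<le> ?C * (\<Sum>i\<in>A. exp (\<theta> * q i) * (1 + d u i * G))" if u: "u \<in> A" for u
    proof -
      define R' where "R' x = R x - (hinner (R (column u X)) (R x) / hinner (R (column u X)) (R (column u X))) *s R (column u X)" for x
      have un: "u \<notin> - A" using u by simp
      have eq: "- (A - {u}) = insert u (- A)" by auto
      note ins = residual_map_insert[OF R un refl R_nz[OF u], of R', OF R'_def[THEN ext]]
      have "perm_avg (A - {u}) (\<lambda>\<pi>. of_bool (\<not> columns_independent X (- (A - {u}) \<union> set (take r \<pi>))))
          \<le> ?C * (\<Sum>i\<in>A - {u}. exp (\<theta> * (1 - (norm (R' (column i X)))\<^sup>2)))"
      proof (rule Suc.IH)
        show "residual_map X (- (A - {u})) R'" unfolding eq by (rule ins(1))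
        show "columns_independent X (- (A - {u}))" unfolding eq
          by (rule columns_independent_insert[OF R un R_nz[OF u] Suc.prems(2)])
        show "m + real r \<le> real (card (A - {u}))"
          using Suc.prems(3) u card_A by (simp add: card_Diff_singleton of_nat_diff Suc_le_eq)
      qed
      also have "(\<Sum>i\<in>A - {u}. exp (\<theta> * (1 - (norm (R' (column i X)))\<^sup>2)))
          \<le> (\<Sum>i\<in>A - {u}. exp (\<theta> * q i) * (1 + d u i * G))"
      proof (rule sum_mono)
        fix i assume i: "i \<in> A - {u}"
        have "1 - (norm (R' (column i X)))\<^sup>2 = q i + d u i"
          unfolding ins(2) by (simp add: q_def d_def)
        hence "exp (\<theta> * (1 - (norm (R' (column i X)))\<^sup>2)) = exp (\<theta> * q i) * exp (\<theta> * d u i)"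
          by (simp add: distrib_left exp_add)
        also have "\<dots> \<le> exp (\<theta> * q i) * (1 + d u i * G)"
          unfolding G_def using i u d_le d0 b0 by (intro mult_left_mono exp_le_chord) auto
        finally show "exp (\<theta> * (1 - (norm (R' (column i X)))\<^sup>2)) \<le> exp (\<theta> * q i) * (1 + d u i * G)" .
      qed
      also have "\<dots> \<le> (\<Sum>i\<in>A. exp (\<theta> * q i) * (1 + d u i * G))"
        using A d0 G0 by (intro sum_mono2) auto
      finally show ?thesis using C0 by (simp add: eq mult_left_mono)
    qed
    have "perm_avg A (\<lambda>\<pi>. of_bool (\<not> columns_independent X (- A \<union> set (take (Suc r) \<pi>))))
        \<le> (\<Sum>u\<in>A. ?C * (\<Sum>i\<in>A. exp (\<theta> * q i) * (1 + d u i * G))) / card A"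
      unfolding perm_avg_split_first[OF A] by (intro divide_right_mono sum_mono step) auto
    also have "\<dots> = ?C * (\<Sum>i\<in>A. exp (\<theta> * q i) * ((\<Sum>u\<in>A. 1 + d u i * G) / card A))"
    proof -
      have "(\<Sum>u\<in>A. ?C * (\<Sum>i\<in>A. exp (\<theta> * q i) * (1 + d u i * G))) / card A
          = ?C * ((\<Sum>u\<in>A. \<Sum>i\<in>A. exp (\<theta> * q i) * (1 + d u i * G)) / card A)"
        by (simp only: sum_distrib_left[symmetric] times_divide_eq_right)
      also have "(\<Sum>u\<in>A. \<Sum>i\<in>A. exp (\<theta> * q i) * (1 + d u i * G))
          = (\<Sum>i\<in>A. \<Sum>u\<in>A. exp (\<theta> * q i) * (1 + d u i * G))" by (rule sum.swap)
      finally show ?thesis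
        by (simp only: sum_divide_distrib sum_distrib_left times_divide_eq_right)
    qed
    also have "\<dots> \<le> ?C * (\<Sum>i\<in>A. exp (\<theta> * q i) * (1 + g))"
    proof (intro mult_left_mono sum_mono)
      fix i assume i: "i \<in> A"
      have N: "0 < real (card A)" using A by (simp add: card_gt_0_iff)
      have "(\<Sum>u\<in>A. 1 + d u i * G) / card A = 1 + (\<Sum>u\<in>A. d u i) * G / card A"
        using N A(2) by (simp add: sum.distrib sum_distrib_right add_divide_distrib)
      also have "(\<Sum>u\<in>A. d u i) * G / card A \<le> (spectral_norm X)\<^sup>2 / (1 - \<kappa>) * G / m"
        using sum_d[OF i] G0 mA m \<kappa> by (intro frac_le mult_right_mono) auto
      also have "\<dots> = g" by (simp add: g_def G_def)
      finally show "(\<Sum>u\<in>A. 1 + d u i * G) / card A \<le> 1 + g" by simp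
    qed (use C0 in auto)
    also have "\<dots> = exp (- (\<theta> * \<kappa>)) * (1 + g) ^ Suc r * (\<Sum>i\<in>A. exp (\<theta> * q i))"
      by (simp add: sum_distrib_right[symmetric])
    finally show ?thesis unfolding q_def .
  qed
qed

section \<open>Exact recovery once the support is known\<close>

lemma mprod_assoc: "mprod B (mprod C M N) P = mprod C M (mprod B N P)"
proof (intro ext)
  fix a d
  have "mprod B (mprod C M N) P a d = (\<Sum>b\<in>B. \<Sum>c\<in>C. M a c * N c b * P b d)"
    by (simp add: mprod_def sum_distrib_right)
  also have "\<dots> = (\<Sum>c\<in>C. \<Sum>b\<in>B. M a c * N c b * P b d)" by (rule sum.swap)
  finally show "mprod B (mprod C M N) P a d = mprod C M (mprod B N P) a d"
    by (simp add: mprod_def sum_distrib_left mult.assoc)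
qed

text \<open>
  The rows of the pseudoinverse are the conjugated dual vectors \<open>g c\<close>. Expanding each \<open>g c\<close> in the
  columns shows that its coefficients are the inner products of the dual vectors, so \<open>M G\<close> is visibly
  Hermitian. For uniqueness, independence forces \<open>G' M = 1\<close> for any pseudoinverse \<open>G'\<close>; then \<open>M G\<close> and
  \<open>M G'\<close> are Hermitian and absorb each other, hence agree, and \<open>G' = G M G' = G M G = G\<close>.
\<close>

lemma pseudoinverse_left_inverse:
  fixes X :: "complex ^ 'p ^ 'n"
  assumes I: "columns_independent X I" and cd: "c \<in> I" "d \<in> I"
  shows "mprod UNIV (pseudoinverse UNIV I (\<lambda>r c. X $ r $ c)) (\<lambda>r c. X $ r $ c) c d = of_bool (c = d)"
proof -
  let ?M = "\<lambda>r c. X $ r $ c"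
  have "\<forall>c\<in>I. \<exists>g. (\<exists>\<alpha>. g = (\<Sum>d\<in>I. \<alpha> d *s column d X)) \<and>
                (\<forall>d\<in>I. hinner g (column d X) = (if d = c then 1 else 0))"
    using columns_independent_dual_vector[OF I] by blast
  from bchoice[OF this] obtain g where g_ex: "\<forall>c\<in>I. \<exists>\<alpha>. g c = (\<Sum>d\<in>I. \<alpha> d *s column d X)"
    and g_dual: "\<forall>c\<in>I. \<forall>d\<in>I. hinner (g c) (column d X) = (if d = c then 1 else 0)" by blast
  from bchoice[OF g_ex] obtain \<alpha> where
    g: "\<And>c. c \<in> I \<Longrightarrow> g c = (\<Sum>d\<in>I. \<alpha> c d *s column d X)" by blast
  have dual: "hinner (g c) (column d X) = of_bool (c = d)" if "c \<in> I" "d \<in> I" for c d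
    using g_dual that by auto
  define G where "G c r = (if c \<in> I then cnj (g c $ r) else 0)" for c r
  have [simp]: "finite I" by simp
  have GM: "mprod UNIV G ?M c d = of_bool (c = d)" if "c \<in> I" "d \<in> I" for c d
    using dual[OF that] that by (simp add: mprod_def G_def hinner_def column_def)
  have left_id: "mprod I N G' c r = G' c r"
    if "c \<in> I" "\<And>d. d \<in> I \<Longrightarrow> N c d = of_bool (c = d)" for N and G' :: "'p \<Rightarrow> 'n \<Rightarrow> complex" and c r
  proof -
    have "mprod I N G' c r = (\<Sum>d\<in>I. of_bool (c = d) * G' d r)"
      unfolding mprod_def using that by (intro sum.cong) auto
    also have "\<dots> = (\<Sum>d\<in>I. if c = d then G' d r else 0)" by (intro sum.cong) auto
    also have "\<dots> = G' c r" using that(1) by simp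
    finally show ?thesis .
  qed
  have right_id: "mprod I M' N r c = M' r c"
    if "c \<in> I" "\<And>d. d \<in> I \<Longrightarrow> N d c = of_bool (d = c)" for N and M' :: "'n \<Rightarrow> 'p \<Rightarrow> complex" and c r
  proof -
    have "mprod I M' N r c = (\<Sum>d\<in>I. M' r d * of_bool (d = c))"
      unfolding mprod_def using that by (intro sum.cong) auto
    also have "\<dots> = (\<Sum>d\<in>I. if d = c then M' r d else 0)" by (intro sum.cong) auto
    also have "\<dots> = M' r c" using that(1) by simp
    finally show ?thesis .
  qed
  have gram: "\<alpha> c d = hinner (g d) (g c)" if "c \<in> I" "d \<in> I" for c d
  proof -
    have "hinner (g d) (g c) = (\<Sum>e\<in>I. \<alpha> c e * of_bool (d = e))"
      unfolding g[OF that(1)] hinner_sum_right hinner_scale_right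
      by (intro sum.cong refl) (use dual that in auto)
    also have "\<dots> = (\<Sum>e\<in>I. if d = e then \<alpha> c e else 0)" by (intro sum.cong) auto
    also have "\<dots> = \<alpha> c d" using that by simp
    finally show ?thesis ..
  qed
  have MG: "mprod I ?M G r s = (\<Sum>c\<in>I. \<Sum>d\<in>I. X $ r $ c * hinner (g c) (g d) * cnj (X $ s $ d))" for r s
  proof -
    have "cnj (g c $ s) = (\<Sum>d\<in>I. hinner (g c) (g d) * cnj (X $ s $ d))" if "c \<in> I" for c
    proof -
      have "g c $ s = (\<Sum>d\<in>I. \<alpha> c d * X $ s $ d)"
        by (subst g[OF that]) (simp add: column_def)
      hence "cnj (g c $ s) = (\<Sum>d\<in>I. cnj (\<alpha> c d) * cnj (X $ s $ d))" by simp
      also have "\<dots> = (\<Sum>d\<in>I. hinner (g c) (g d) * cnj (X $ s $ d))"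
        by (intro sum.cong refl) (simp add: gram that cnj_hinner)
      finally show ?thesis .
    qed
    hence "mprod I ?M G r s = (\<Sum>c\<in>I. X $ r $ c * (\<Sum>d\<in>I. hinner (g c) (g d) * cnj (X $ s $ d)))"
      unfolding mprod_def G_def by (intro sum.cong refl) simp
    thus ?thesis by (simp only: sum_distrib_left mult.assoc)
  qed
  have G: "is_pseudoinverse UNIV I ?M G"
    unfolding is_pseudoinverse_def
  proof (intro conjI ballI allI impI)
    fix r c assume c: "c \<in> I"
    show "mprod UNIV (mprod I ?M G) ?M r c = ?M r c"
      unfolding mprod_assoc by (rule right_id) (use c GM in auto)
    show "mprod I (mprod UNIV G ?M) G c r = G c r" by (rule left_id) (use c GM in auto)
  next
    fix r s
    show "cnj (mprod I ?M G s r) = mprod I ?M G r s"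
    proof -
      have "cnj (mprod I ?M G s r) = (\<Sum>c\<in>I. \<Sum>d\<in>I. X $ r $ d * hinner (g d) (g c) * cnj (X $ s $ c))"
        unfolding MG cnj_sum complex_cnj_mult cnj_hinner complex_cnj_cnj
        by (intro sum.cong refl) (simp only: mult_ac)
      also have "\<dots> = mprod I ?M G r s" unfolding MG by (rule sum.swap)
      finally show ?thesis .
    qed
  next
    fix c d assume "c \<in> I" "d \<in> I"
    thus "cnj (mprod UNIV G ?M d c) = mprod UNIV G ?M c d" by (auto simp: GM)
  qed (auto simp: G_def)
  have unique: "G' = G" if G': "is_pseudoinverse UNIV I ?M G'" for G'
  proof -
    have G'M: "mprod UNIV G' ?M c d = of_bool (c = d)" if c: "c \<in> I" and d: "d \<in> I" for c d
    proof -
      \<comment> \<open>From \<open>M G' M = M\<close>, the entries of column \<open>d\<close> of \<open>G' M - 1\<close> are the coefficients of a linear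
        relation between the columns.\<close>
      let ?e = "\<lambda>c. mprod UNIV G' ?M c d - of_bool (c = d)"
      have "(\<Sum>c\<in>I. ?e c *s column c X) $ r = 0" for r
      proof -
        have "(\<Sum>c\<in>I. ?e c *s column c X) $ r = mprod I ?M (\<lambda>c d. ?e c) r d"
          by (simp add: mprod_def column_def algebra_simps)
        also have "\<dots> = mprod I ?M (mprod UNIV G' ?M) r d - mprod I ?M (\<lambda>c d. of_bool (c = d)) r d"
          unfolding mprod_def[of I] by (simp only: right_diff_distrib sum_subtractf)
        also have "mprod I ?M (mprod UNIV G' ?M) r d = ?M r d"
          using G' d unfolding is_pseudoinverse_def mprod_assoc by blast
        also have "mprod I ?M (\<lambda>c d. of_bool (c = d)) r d = ?M r d" by (rule right_id) (use d in auto)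
        finally show ?thesis by simp
      qed
      hence "(\<Sum>c\<in>I. ?e c *s column c X) = 0" by (simp add: vec_eq_iff)
      hence "?e c = 0" using I[unfolded columns_independent_def, THEN spec, of ?e] c by blast
      thus ?thesis by simp
    qed
    have absorb: "mprod UNIV (mprod I ?M A) (mprod I ?M B) r s = mprod I ?M B r s"
      if "\<And>c d. c \<in> I \<Longrightarrow> d \<in> I \<Longrightarrow> mprod UNIV A ?M c d = of_bool (c = d)"
      for A B :: "'p \<Rightarrow> 'n \<Rightarrow> complex" and r s
    proof -
      have "mprod UNIV (mprod I ?M A) (mprod I ?M B) r s = mprod I ?M (mprod I (mprod UNIV A ?M) B) r s"
        by (simp add: mprod_assoc)
      also have "\<dots> = (\<Sum>c\<in>I. ?M r c * mprod I (mprod UNIV A ?M) B c s)" by (simp add: mprod_def)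
      also have "\<dots> = (\<Sum>c\<in>I. ?M r c * B c s)"
      proof (intro sum.cong refl arg_cong2[where f = "(*)"])
        fix c assume "c \<in> I"
        thus "mprod I (mprod UNIV A ?M) B c s = B c s" by (intro left_id) (use that in auto)
      qed
      finally show ?thesis by (simp add: mprod_def)
    qed
    have herm: "cnj (mprod I ?M A s r) = mprod I ?M A r s" if "is_pseudoinverse UNIV I ?M A" for A s r
      using that unfolding is_pseudoinverse_def by blast
    have MG_eq: "mprod I ?M G r s = mprod I ?M G' r s" for r s
    proof -
      have "mprod I ?M G r s = cnj (mprod I ?M G s r)" by (rule herm[OF G, symmetric])
      also have "\<dots> = cnj (mprod UNIV (mprod I ?M G') (mprod I ?M G) s r)"
        by (simp only: absorb[OF G'M])
      also have "\<dots> = (\<Sum>t\<in>UNIV. cnj (mprod I ?M G' s t) * cnj (mprod I ?M G t r))"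
        by (subst (1) mprod_def) simp
      also have "\<dots> = (\<Sum>t\<in>UNIV. mprod I ?M G r t * mprod I ?M G' t s)"
        by (intro sum.cong refl) (simp only: herm[OF G] herm[OF G'] mult.commute)
      also have "\<dots> = mprod UNIV (mprod I ?M G) (mprod I ?M G') r s" by (simp only: mprod_def[of UNIV])
      also have "\<dots> = mprod I ?M G' r s" by (rule absorb[OF GM])
      finally show ?thesis .
    qed
    show ?thesis
    proof (intro ext)
      fix c r
      show "G' c r = G c r"
      proof (cases "c \<in> I")
        case True
        have "G' c r = mprod I (mprod UNIV G ?M) G' c r" by (rule left_id[symmetric]) (use True GM in auto)
        also have "\<dots> = mprod UNIV G (mprod I ?M G') c r" by (simp add: mprod_assoc)
        also have "\<dots> = mprod UNIV G (mprod I ?M G) c r" by (simp add: mprod_def[of UNIV] MG_eq)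
        also have "\<dots> = mprod I (mprod UNIV G ?M) G c r" by (simp add: mprod_assoc)
        also have "\<dots> = G c r" by (rule left_id) (use True GM in auto)
        finally show ?thesis .
      next
        case False
        thus ?thesis using G G' unfolding is_pseudoinverse_def by simp
      qed
    qed
  qed
  have "pseudoinverse UNIV I ?M = G"
    unfolding pseudoinverse_def using G unique by (rule the_equality)
  thus ?thesis using GM cd by simp
qed

lemma ost_recovers:
  fixes X :: "complex ^ 'p ^ 'n"
  assumes model: "ost_model X (X *v \<beta>) thr = true_model \<beta>"
    and indep: "columns_independent X (true_model \<beta>)"
  shows "ost X (X *v \<beta>) thr = \<beta>"
proof -
  let ?I = "true_model \<beta>" and ?M = "\<lambda>r c. X $ r $ c"
  let ?G = "pseudoinverse UNIV ?I ?M"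
  have "(\<Sum>r\<in>UNIV. ?G i r * (X *v \<beta>) $ r) = \<beta> $ i" if i: "i \<in> ?I" for i
  proof -
    have y: "(X *v \<beta>) $ r = (\<Sum>c\<in>?I. X $ r $ c * \<beta> $ c)" for r
      unfolding matrix_vector_mult_def by (auto intro!: sum.mono_neutral_right simp: true_model_def)
    have "(\<Sum>r\<in>UNIV. ?G i r * (X *v \<beta>) $ r) = (\<Sum>r\<in>UNIV. \<Sum>c\<in>?I. ?G i r * ?M r c * \<beta> $ c)"
      by (simp add: y sum_distrib_left mult.assoc)
    also have "\<dots> = (\<Sum>c\<in>?I. \<Sum>r\<in>UNIV. ?G i r * ?M r c * \<beta> $ c)" by (rule sum.swap)
    also have "\<dots> = (\<Sum>c\<in>?I. mprod UNIV ?G ?M i c * \<beta> $ c)"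
      by (simp add: mprod_def sum_distrib_right)
    also have "\<dots> = (\<Sum>c\<in>?I. if i = c then \<beta> $ c else 0)"
      by (intro sum.cong refl) (simp add: pseudoinverse_left_inverse[OF indep i])
    also have "\<dots> = \<beta> $ i" using i by simp
    finally show ?thesis .
  qed
  thus ?thesis unfolding ost_def Let_def model
    by (simp add: vec_eq_iff true_model_def)
qed

section \<open>Thresholding finds the support\<close>

lemma hermitian_transpose_mult_nth:
  "(hermitian_transpose X *v y) $ i = hinner (column i X) y"
  by (simp add: hermitian_transpose_def matrix_vector_mult_def hinner_def column_def)

lemma sum_signal_mult:
  "(\<Sum>x\<in>UNIV. signal k z \<pi> $ x * a x) = (\<Sum>j<k. z j * a (\<pi> ! j))"
proof -
  have "(\<Sum>x\<in>UNIV. signal k z \<pi> $ x * a x) = (\<Sum>x\<in>UNIV. \<Sum>j<k. if \<pi> ! j = x then z j * a x else 0)"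
    by (simp add: signal_def sum_distrib_right if_distrib[of "\<lambda>u. u * _"] cong: if_cong)
  also have "\<dots> = (\<Sum>j<k. z j * a (\<pi> ! j))"
    by (subst sum.swap) simp
  finally show ?thesis .
qed

text \<open>
  Setting the diagonal term to 0, instead of omitting it, writes the deviation as a sum of one and
  the same function over the support, for indices inside and outside the support alike.
\<close>

lemma hinner_column_mult_minus_nth:
  fixes X :: "complex ^ 'p ^ 'n"
  assumes unit: "\<And>j. norm (column j X) = 1"
  shows "hinner (column i X) (X *v \<beta>) - \<beta> $ i
       = (\<Sum>x\<in>UNIV. \<beta> $ x * (if x = i then 0 else hinner (column i X) (column x X)))"
proof -
  have "hinner (column i X) (X *v \<beta>) = (\<Sum>x\<in>UNIV. \<beta> $ x * hinner (column i X) (column x X))"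
    unfolding matrix_vector_mult_sum_columns hinner_sum_right hinner_scale_right ..
  also have "\<dots> = \<beta> $ i * hinner (column i X) (column i X)
      + (\<Sum>x\<in>UNIV - {i}. \<beta> $ x * hinner (column i X) (column x X))"
    by (subst sum.remove[of _ i]) auto
  also have "hinner (column i X) (column i X) = 1" by (simp add: hinner_self unit)
  also have "(\<Sum>x\<in>UNIV - {i}. \<beta> $ x * hinner (column i X) (column x X))
     = (\<Sum>x\<in>UNIV. \<beta> $ x * (if x = i then 0 else hinner (column i X) (column x X)))"
    by (rule sum.mono_neutral_cong_left) auto
  finally show ?thesis by simp
qed

text \<open>
  Let \<open>E\<close> be the bound on the deviations and \<open>\<tau>\<close> the threshold. It suffices that \<open>E \<le> \<tau>\<close> and that
  \<open>\<tau> + E\<close> is below every nonzero \<open>|\<beta>\<^sub>i|\<close>. Summing the squares of the lower bounds on \<open>|\<beta>\<^sub>i|\<close> over the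
  support gives \<open>k (43 m)\<^sup>2 \<le> \<parallel>\<beta>\<parallel>\<^sup>2\<close>, and this makes \<open>\<parallel>y\<parallel>\<^sup>2 - \<parallel>\<beta>\<parallel>\<^sup>2 = \<langle>\<beta>, f - \<beta>\<rangle>\<close> at most a third of
  \<open>\<parallel>\<beta>\<parallel>\<^sup>2\<close>. Since \<open>1 - exp (-1/2)\<close> lies between 1/3 and 1/2, the threshold lies between \<open>E\<close> and \<open>2 E\<close>, and
  \<open>3 E = 3 \<surd>200 m < 43 m\<close>.
\<close>

lemma ost_model_eq_true_model:
  fixes X :: "complex ^ 'p ^ 'n" and \<beta> :: "complex ^ 'p"
  defines "L \<equiv> ln (real CARD('p))" and "\<mu> \<equiv> worst_case_coherence X"
  assumes \<mu>: "0 \<le> \<mu>" and L: "0 \<le> L"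
    and large: "\<And>i. i \<in> true_model \<beta> \<Longrightarrow> 43 * \<mu> * sqrt L * norm \<beta> \<le> cmod (\<beta> $ i)"
    and dev: "\<And>i. cmod (hinner (column i X) (X *v \<beta>) - \<beta> $ i) \<le> 10 * \<mu> * sqrt (2 * L) * norm \<beta>"
  shows "ost_model X (X *v \<beta>) (ost_threshold X (X *v \<beta>)) = true_model \<beta>"
proof (cases "\<beta> = 0")
  case True
  thus ?thesis
    by (auto simp: ost_model_def true_model_def ost_threshold_def)
next
  case False
  define b where "b = norm \<beta>"
  define y where "y = X *v \<beta>"
  define m where "m = \<mu> * sqrt L * b"
  define k where "k = card (true_model \<beta>)"
  define E where "E = 10 * \<mu> * sqrt (2 * L) * b"
  define e where "e = exp (- 1 / 2 :: real)"
  have b: "0 < b" using False by (simp add: b_def)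
  have m: "0 \<le> m" using \<mu> L b by (simp add: m_def)
  have E: "E = sqrt 200 * m" "0 \<le> E"
  proof -
    have "sqrt 200 = 10 * sqrt 2" using real_sqrt_mult[of 100 2] by simp
    thus "E = sqrt 200 * m" by (simp add: E_def m_def real_sqrt_mult)
    show "0 \<le> E" using \<mu> L b by (simp add: E_def)
  qed
  have energy: "(\<Sum>i\<in>true_model \<beta>. (cmod (\<beta> $ i))\<^sup>2) = b\<^sup>2"
    unfolding b_def norm_vec_squared
    by (rule sum.mono_neutral_left) (auto simp: true_model_def)
  have km: "real k * (43 * m)\<^sup>2 \<le> b\<^sup>2"
  proof -
    have "real k * (43 * m)\<^sup>2 = (\<Sum>i\<in>true_model \<beta>. (43 * m)\<^sup>2)" by (simp add: k_def)
    also have "\<dots> \<le> (\<Sum>i\<in>true_model \<beta>. (cmod (\<beta> $ i))\<^sup>2)"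
      using large m by (intro sum_mono power_mono) (auto simp: m_def b_def mult_ac)
    finally show ?thesis using energy by simp
  qed
  have y_energy: "\<bar>(norm y)\<^sup>2 - b\<^sup>2\<bar> \<le> b\<^sup>2 / 3"
  proof -
    define l1 where "l1 = (\<Sum>i\<in>true_model \<beta>. cmod (\<beta> $ i))"
    have "complex_of_real ((norm y)\<^sup>2 - b\<^sup>2) = hinner (X *v \<beta>) y - hinner \<beta> \<beta>"
      by (simp add: hinner_self y_def b_def)
    also have "hinner (X *v \<beta>) y = (\<Sum>i\<in>UNIV. cnj (\<beta> $ i) * hinner (column i X) y)"
      unfolding matrix_vector_mult_sum_columns hinner_sum_left hinner_scale_left ..
    also have "\<dots> - hinner \<beta> \<beta> = (\<Sum>i\<in>UNIV. cnj (\<beta> $ i) * (hinner (column i X) y - \<beta> $ i))"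
      by (simp add: hinner_def[of \<beta> \<beta>] sum_subtractf right_diff_distrib)
    also have "\<dots> = (\<Sum>i\<in>true_model \<beta>. cnj (\<beta> $ i) * (hinner (column i X) y - \<beta> $ i))"
      by (rule sum.mono_neutral_right) (auto simp: true_model_def)
    finally have "\<bar>(norm y)\<^sup>2 - b\<^sup>2\<bar> = cmod \<dots>"
      by (metis norm_of_real real_norm_def)
    also have "\<dots> \<le> (\<Sum>i\<in>true_model \<beta>. cmod (\<beta> $ i) * E)"
      by (rule order_trans[OF norm_sum], intro sum_mono)
         (use dev in \<open>auto simp: norm_mult E_def b_def y_def intro!: mult_left_mono\<close>)
    also have "\<dots> = l1 * E" by (simp add: l1_def sum_distrib_right)
    finally have le: "\<bar>(norm y)\<^sup>2 - b\<^sup>2\<bar> \<le> l1 * E" .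
    have l1: "0 \<le> l1" by (simp add: l1_def sum_nonneg)
    have "l1\<^sup>2 \<le> real k * b\<^sup>2"
      unfolding energy[symmetric] l1_def k_def
      using sum_squared_le_sum_of_squares[of "\<lambda>i. cmod (\<beta> $ i)" "true_model \<beta>"]
      by (simp add: mult.commute)
    hence "(l1 * E)\<^sup>2 \<le> (real k * b\<^sup>2) * (200 * m\<^sup>2)"
      unfolding power_mult_distrib E(1) by (simp add: mult_right_mono)
    also have "\<dots> = 200 / 1849 * (b\<^sup>2 * (real k * (43 * m)\<^sup>2))" by (simp add: power_mult_distrib)
    also have "\<dots> \<le> 200 / 1849 * (b\<^sup>2 * b\<^sup>2)" using km by (intro mult_left_mono) auto
    also have "\<dots> \<le> 1 / 9 * (b\<^sup>2 * b\<^sup>2)" by (intro mult_right_mono) auto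
    also have "\<dots> = (b\<^sup>2 / 3)\<^sup>2" by (simp add: power2_eq_square)
    finally have "l1 * E \<le> b\<^sup>2 / 3" by (rule power2_le_imp_le) simp
    with le show ?thesis by linarith
  qed
  have e: "1 / 2 \<le> e" "e \<le> 2 / 3"
  proof -
    show "1 / 2 \<le> e" using exp_ge_add_one_self[of "- 1 / 2 :: real"] by (simp add: e_def)
    have "3 / 2 \<le> exp (1 / 2 :: real)" using exp_ge_add_one_self[of "1 / 2 :: real"] by simp
    moreover have "e = 1 / exp (1 / 2)" by (simp add: e_def exp_minus field_simps)
    ultimately show "e \<le> 2 / 3" by (simp add: divide_le_eq)
  qed
  define \<tau> where "\<tau> = ost_threshold X y"
  have \<tau>0: "0 \<le> \<tau>"
    using \<mu> L e unfolding \<tau>_def ost_threshold_def e_def[symmetric] \<mu>_def[symmetric] L_def[symmetric] by simp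
  have \<tau>2: "\<tau>\<^sup>2 = 200 * (\<mu> * sqrt L)\<^sup>2 * ((norm y)\<^sup>2 / (1 - e))"
    using L e unfolding \<tau>_def ost_threshold_def e_def[symmetric] \<mu>_def[symmetric] L_def[symmetric]
    by (simp add: power_mult_distrib)
  have ratio: "b\<^sup>2 \<le> (norm y)\<^sup>2 / (1 - e)" "(norm y)\<^sup>2 / (1 - e) \<le> 4 * b\<^sup>2"
  proof -
    have "b\<^sup>2 * (1 - e) \<le> b\<^sup>2 * (1 / 2)" using e by (intro mult_left_mono) auto
    also have "\<dots> \<le> (norm y)\<^sup>2" using y_energy zero_le_power2[of b] by linarith
    finally show "b\<^sup>2 \<le> (norm y)\<^sup>2 / (1 - e)" using e by (simp add: le_divide_eq)
    have "(norm y)\<^sup>2 \<le> 4 * b\<^sup>2 * (1 / 3)" using y_energy zero_le_power2[of b] by linarith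
    also have "\<dots> \<le> 4 * b\<^sup>2 * (1 - e)" using e by (intro mult_left_mono) auto
    finally show "(norm y)\<^sup>2 / (1 - e) \<le> 4 * b\<^sup>2" using e by (simp add: divide_le_eq)
  qed
  have E2: "E\<^sup>2 = 200 * (\<mu> * sqrt L)\<^sup>2 * b\<^sup>2"
    unfolding E(1) m_def by (simp add: power_mult_distrib)
  have "E\<^sup>2 \<le> \<tau>\<^sup>2" unfolding E2 \<tau>2 using ratio(1) by (intro mult_left_mono) auto
  hence E_le: "E \<le> \<tau>" using \<tau>0 by (rule power2_le_imp_le)
  have "\<tau>\<^sup>2 \<le> 200 * (\<mu> * sqrt L)\<^sup>2 * (4 * b\<^sup>2)"
    unfolding \<tau>2 using ratio(2) by (intro mult_left_mono) auto
  also have "\<dots> = (2 * E)\<^sup>2" using E2 by (simp add: power_mult_distrib)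
  finally have \<tau>_le: "\<tau> \<le> 2 * E" by (rule power2_le_imp_le) (use E in simp)
  have above: "\<tau> + E < cmod (\<beta> $ i)" if i: "i \<in> true_model \<beta>" for i
  proof (cases "m = 0")
    case True
    have "0 < cmod (\<beta> $ i)" using i by (simp add: true_model_def)
    moreover have "E = 0" using True E(1) by simp
    ultimately show ?thesis using \<tau>_le by linarith
  next
    case False
    have "sqrt 200 < 43 / 3" by (rule real_less_lsqrt) (auto simp: power2_eq_square)
    hence "3 * E < 43 * m" using False m E(1) by simp
    also have "\<dots> \<le> cmod (\<beta> $ i)" using large[OF i] by (simp add: m_def b_def mult_ac)
    finally show ?thesis using \<tau>_le by linarith
  qed
  have dev': "cmod (hinner (column i X) y - \<beta> $ i) \<le> E" for i
    using dev[of i] by (simp add: E_def b_def y_def)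
  have "\<tau> < cmod (hinner (column i X) y) \<longleftrightarrow> i \<in> true_model \<beta>" for i
  proof (cases "i \<in> true_model \<beta>")
    case True
    have "cmod (\<beta> $ i) \<le> cmod (hinner (column i X) y) + E"
      using dev'[of i] norm_triangle_ineq2[of "\<beta> $ i" "hinner (column i X) y"]
      by (simp add: norm_minus_commute)
    with above[OF True] True show ?thesis by auto
  next
    case False
    hence "\<beta> $ i = 0" by (simp add: true_model_def)
    with dev'[of i] E_le False show ?thesis by auto
  qed
  thus ?thesis
    by (auto simp: ost_model_def hermitian_transpose_mult_nth \<tau>_def y_def)
qed

lemma norm_signal_squared:
  assumes "distinct \<pi>" "k \<le> length \<pi>"
  shows "(norm (signal k z \<pi>))\<^sup>2 = (\<Sum>j<k. (cmod (z j))\<^sup>2)"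
proof -
  have inj: "inj_on ((!) \<pi>) {..<k}"
    using assms by (auto simp: inj_on_def nth_eq_iff_index_eq)
  have "(norm (signal k z \<pi>))\<^sup>2 = (\<Sum>x\<in>(!) \<pi> ` {..<k}. (cmod (signal k z \<pi> $ x))\<^sup>2)"
    unfolding norm_vec_squared by (rule sum.mono_neutral_right) (auto intro!: signal_eq_0)
  also have "\<dots> = (\<Sum>j<k. (cmod (z j))\<^sup>2)"
    unfolding sum.reindex[OF inj] by (rule sum.cong) (use assms in \<open>auto simp: signal_nth\<close>)
  finally show ?thesis .
qed

lemma true_model_signal:
  assumes "distinct \<pi>" "k \<le> length \<pi>" "\<And>j. j < k \<Longrightarrow> z j \<noteq> 0"
  shows "true_model (signal k z \<pi>) = set (take k \<pi>)"
proof -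
  have "set (take k \<pi>) = (!) \<pi> ` {..<k}"
    using assms(2) by (metis atLeast0LessThan nth_image)
  moreover have "signal k z \<pi> $ x \<noteq> 0 \<longleftrightarrow> x \<in> (!) \<pi> ` {..<k}" for x
    using assms by (auto simp: signal_nth intro: signal_eq_0)
  ultimately show ?thesis by (auto simp: true_model_def)
qed

section \<open>Probability of failure\<close>

lemma cmod_hinner_le_worst_case_coherence:
  assumes "i \<noteq> j"
  shows "cmod (hinner (column i X) (column j X)) \<le> worst_case_coherence X"
proof -
  have "{cmod (hinner (column i X) (column j X)) | i j. i \<noteq> j}
      \<subseteq> (\<lambda>(i, j). cmod (hinner (column i X) (column j X))) ` UNIV" by auto
  hence "finite {cmod (hinner (column i X) (column j X)) | i j. i \<noteq> j}"
    by (rule finite_subset) simp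
  thus ?thesis unfolding worst_case_coherence_def using assms by (intro Max_ge) auto
qed

lemma cmod_sum_hinner_le_average_coherence:
  fixes X :: "complex ^ 'p ^ 'n"
  assumes "1 < CARD('p)"
  shows "cmod (\<Sum>j\<in>UNIV - {i}. hinner (column i X) (column j X)) \<le> (real CARD('p) - 1) * average_coherence X"
proof -
  have "cmod (\<Sum>j\<in>UNIV - {i}. hinner (column i X) (column j X))
     \<le> Max (range (\<lambda>i. cmod (\<Sum>j\<in>UNIV - {i}. hinner (column i X) (column j X))))"
    by (intro Max_ge) auto
  thus ?thesis using assms by (simp add: average_coherence_def)
qed

lemma one_le_spectral_norm_squared:
  fixes X :: "complex ^ 'p ^ 'n"
  assumes "norm (column j X) = 1"
  shows "1 \<le> (spectral_norm X)\<^sup>2"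
proof -
  have "(cmod (hinner (column j X) (column j X)))\<^sup>2 \<le> (\<Sum>i\<in>UNIV. (cmod (hinner (column i X) (column j X)))\<^sup>2)"
    by (rule member_le_sum) auto
  also have "\<dots> \<le> (spectral_norm X)\<^sup>2 * (norm (column j X))\<^sup>2"
    by (rule sum_hinner_columns_squared_le)
  finally show ?thesis using assms by (simp add: hinner_self)
qed

text \<open>
  The parameters of \<open>random_columns_dependent_le\<close> are \<open>\<kappa> = 1/L\<close>, \<open>b = 2/L\<^sup>2\<close>, \<open>\<theta> = 3 L\<^sup>2\<close> and \<open>m = p/2\<close>. Then
  \<open>\<theta> b = 6\<close> is a constant, so \<open>k g\<close> is of order \<open>k \<parallel>X\<parallel>\<^sup>2 L\<^sup>2 / p\<close> and thus at most \<open>L\<close>, while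
  \<open>exp (- \<theta> \<kappa>) = 1 / p\<^sup>3\<close>.
\<close>

lemma prob_support_columns_dependent_le:
  fixes X :: "complex ^ 'p ^ 'n"
  defines "p \<equiv> real CARD('p)"
  assumes unit: "\<And>j. norm (column j X) = 1"
    and L4: "4 \<le> ln p"
    and coh: "\<And>i j. i \<noteq> j \<Longrightarrow> cmod (hinner (column i X) (column j X)) \<le> 1 / (100 * ln p)"
    and k: "real k * (spectral_norm X)\<^sup>2 * (5000 * ln p) \<le> p"
  shows "perm_avg UNIV (\<lambda>\<pi>. of_bool (\<not> columns_independent X (set (take k \<pi>)))) \<le> 1 / p"
proof -
  define L where "L = ln p"
  define S2 where "S2 = (spectral_norm X)\<^sup>2"
  define b where "b = 2 / L\<^sup>2"
  define g where "g = S2 * ((exp (3 * L\<^sup>2 * b) - 1) / b) / ((1 - 1 / L) * (p / 2))"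
  have L: "4 \<le> L" using L4 by (simp add: L_def)
  have p: "0 < p" by (simp add: p_def)
  have expL: "exp L = p" using p by (simp add: L_def)
  have S2: "1 \<le> S2" unfolding S2_def by (rule one_le_spectral_norm_squared) (rule unit)
  have kSL: "real k * S2 * (5000 * L) \<le> p" using k by (simp add: S2_def L_def)
  have k_half: "real k \<le> p / 2"
  proof -
    have "real k * 1 * 2 \<le> real k * S2 * (5000 * L)" using S2 L by (intro mult_mono) auto
    from order_trans[OF this kSL] show ?thesis by simp
  qed
  have inv_L: "1 / L \<le> 1 / 4" using L by (simp add: divide_le_eq)
  have b_ge: "(1 / (100 * L) + 1 / L)\<^sup>2 / (1 - 1 / L) \<le> b"
  proof -
    have square: "(1 / (100 * L) + 1 / L)\<^sup>2 = (101 / 100)\<^sup>2 / L\<^sup>2"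
      using L by (simp add: field_simps power2_eq_square)
    have "(101 / 100)\<^sup>2 / L\<^sup>2 / (1 - 1 / L) \<le> (101 / 100)\<^sup>2 / L\<^sup>2 / (3 / 4)"
      using inv_L by (intro divide_left_mono) auto
    also have "\<dots> \<le> b"
      unfolding b_def using L by (simp add: field_simps power2_eq_square)
    finally show ?thesis unfolding square .
  qed
  have g_le: "g \<le> 2500 * S2 * L\<^sup>2 / p"
  proof -
    have "exp 6 = (exp 1 :: real) ^ 6" by (simp flip: exp_of_nat_mult)
    also have "\<dots> \<le> (272 / 100) ^ 6" using e_less_272 by (intro power_mono) auto
    also have "\<dots> \<le> 406" by (simp add: power_divide)
    finally have e6: "exp 6 \<le> (406 :: real)" .
    have "3 * L\<^sup>2 * b = 6" using L by (simp add: b_def)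
    hence "g = S2 * ((exp 6 - 1) * L\<^sup>2 / 2) / ((1 - 1 / L) * (p / 2))" by (simp add: g_def b_def)
    also have "\<dots> \<le> S2 * (405 * L\<^sup>2 / 2) / ((3 / 4) * (p / 2))"
      using e6 S2 inv_L p
      by (intro frac_le mult_left_mono mult_right_mono divide_right_mono) auto
    also have "\<dots> = 540 * S2 * L\<^sup>2 / p" by simp
    also have "\<dots> \<le> 2500 * S2 * L\<^sup>2 / p"
      using p S2 by (intro divide_right_mono mult_right_mono) auto
    finally show ?thesis .
  qed
  have g0: "0 \<le> g"
    unfolding g_def using S2 p inv_L L by (intro divide_nonneg_nonneg mult_nonneg_nonneg) (auto simp: b_def)
  have growth: "(1 + g) ^ k \<le> p"
  proof -
    have "real k * g \<le> real k * (2500 * S2 * L\<^sup>2 / p)" using g_le by (intro mult_left_mono) auto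
    also have "\<dots> = (real k * S2 * (5000 * L)) * (L / (2 * p))"
      using p by (simp add: power2_eq_square)
    also have "\<dots> \<le> p * (L / (2 * p))" using kSL L p by (intro mult_right_mono) auto
    also have "\<dots> \<le> L" using p L by simp
    finally have kg: "real k * g \<le> L" .
    have "(1 + g) ^ k \<le> exp g ^ k" using g0 exp_ge_add_one_self[of g] by (intro power_mono) auto
    also have "\<dots> = exp (real k * g)" by (rule exp_of_nat_mult[symmetric])
    also have "\<dots> \<le> exp L" using kg by simp
    finally show ?thesis by (simp add: expL)
  qed
  have "perm_avg UNIV (\<lambda>\<pi>. of_bool (\<not> columns_independent X (- UNIV \<union> set (take k \<pi>))))
      \<le> exp (- (3 * L\<^sup>2 * (1 / L))) * (1 + g) ^ k * (\<Sum>i\<in>UNIV. exp (3 * L\<^sup>2 * (1 - (norm (column i X))\<^sup>2)))"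
    unfolding g_def S2_def
  proof (rule random_columns_dependent_le[OF unit, where \<mu> = "1 / (100 * L)" and R = "\<lambda>x. x"])
    show "residual_map X (- UNIV) (\<lambda>x. x)" by (simp add: residual_map_empty)
    show "columns_independent X (- UNIV)" by (simp add: columns_independent_def)
    show "p / 2 + real k \<le> real CARD('p)" using k_half by (simp add: p_def)
    show "cmod (hinner (column i X) (column j X)) \<le> 1 / (100 * L)" if "i \<noteq> j" for i j
      using coh[OF that] by (simp add: L_def)
  qed (use b_ge L p in auto)
  also have "3 * L\<^sup>2 * (1 / L) = 3 * L" using L by (simp add: power2_eq_square)
  also have "(\<Sum>i\<in>(UNIV :: 'p set). exp (3 * L\<^sup>2 * (1 - (norm (column i X))\<^sup>2))) = p"
    by (simp add: unit p_def)
  also have "exp (- (3 * L)) = 1 / p ^ 3"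
    by (simp add: exp_minus expL flip: exp_of_nat_mult)
       (metis expL exp_of_nat_mult inverse_eq_divide of_nat_numeral)
  also have "1 / p ^ 3 * (1 + g) ^ k * p \<le> 1 / p ^ 3 * p * p"
    using growth p by (intro mult_right_mono mult_left_mono) auto
  also have "\<dots> = 1 / p" using p by (simp add: power3_eq_cube)
  finally show ?thesis by simp
qed

text \<open>
  With \<open>m = \<mu> \<parallel>z\<parallel>\<close>, the sampling tail is used with \<open>s = 10 \<surd>L m\<close> and \<open>t = \<surd>L / m\<close>. The mean contributes at most
  \<open>t m = \<surd>L\<close>, because \<open>\<parallel>z\<parallel>\<^sub>1 \<le> \<surd>k \<parallel>z\<parallel>\<close> and \<open>k \<le> n\<close> cancel the factor \<open>1 / \<surd>n\<close> of the average
  coherence. The exponent is then \<open>2 L + \<surd>L - 10 L \<le> - 7 L\<close>. If \<open>m = 0\<close>, the deviation vanishes.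
\<close>

lemma prob_correlation_deviation_le:
  fixes X :: "complex ^ 'p ^ 'n" and z :: "nat \<Rightarrow> complex"
  defines "p \<equiv> real CARD('p)" and "\<mu> \<equiv> worst_case_coherence X"
  assumes L4: "4 \<le> ln p"
    and avg: "average_coherence X \<le> \<mu> / sqrt (real CARD('n))"
    and k: "k \<le> CARD('n)" "2 * k \<le> CARD('p)"
  shows "perm_avg UNIV (\<lambda>\<pi>. of_bool (10 * \<mu> * sqrt (2 * ln p) * sqrt (\<Sum>j<k. (cmod (z j))\<^sup>2)
             < cmod (\<Sum>j<k. z j * (if \<pi> ! j = i then 0 else hinner (column i X) (column (\<pi> ! j) X)))))
         \<le> 4 * exp (- 7 * ln p)"
proof -
  define L where "L = ln p"
  define Q where "Q = (\<Sum>j<k. (cmod (z j))\<^sup>2)"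
  define a where "a x = (if x = i then 0 else hinner (column i X) (column x X))" for x
  have L: "4 \<le> L" using L4 by (simp add: L_def)
  have p1: "1 < p" 
  proof (rule ccontr)
    assume "\<not> 1 < p"
    moreover have "0 < p" by (simp add: p_def)
    ultimately have "ln p \<le> 0" by (simp add: ln_le_zero_iff)
    with L4 show False by simp
  qed
  hence "1 < CARD('p)" by (simp add: p_def)
  then obtain i' where "i' \<noteq> i"
    by (metis One_nat_def UNIV_I card_le_Suc0_iff_eq finite not_le)
  have \<mu>0: "0 \<le> \<mu>"
    unfolding \<mu>_def using cmod_hinner_le_worst_case_coherence[OF \<open>i' \<noteq> i\<close>] norm_ge_zero order_trans by blast
  have a_le: "cmod (a x) \<le> \<mu>" for x
    using \<mu>0 cmod_hinner_le_worst_case_coherence[of i x X] by (auto simp: a_def \<mu>_def)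
  have Q0: "0 \<le> Q" by (simp add: Q_def sum_nonneg)
  have goal: "perm_avg UNIV (\<lambda>\<pi>. of_bool (sqrt 2 * (10 * \<mu> * sqrt L * sqrt Q) < cmod (\<Sum>j<k. z j * a (\<pi> ! j))))
     \<le> 4 * exp (- 7 * L)"
  proof (cases "\<mu> * sqrt Q = 0")
    case True
    hence "\<mu> = 0 \<or> sqrt Q = 0" by simp
    hence zero: "(\<Sum>j<k. z j * a (\<pi> ! j)) = 0" for \<pi>
    proof
      assume "\<mu> = 0"
      hence "a x = 0" for x using a_le[of x] by simp
      thus ?thesis by simp
    next
      assume "sqrt Q = 0"
      hence "\<forall>j\<in>{..<k}. (cmod (z j))\<^sup>2 = 0"
        unfolding Q_def by (subst (asm) real_sqrt_eq_zero_cancel_iff, subst (asm) sum_nonneg_eq_0_iff) auto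
      thus ?thesis by simp
    qed
    have "sqrt 2 * (10 * \<mu> * sqrt L * sqrt Q) = 0" using True by auto
    hence "perm_avg UNIV (\<lambda>\<pi>. of_bool (sqrt 2 * (10 * \<mu> * sqrt L * sqrt Q) < cmod (\<Sum>j<k. z j * a (\<pi> ! j)))) = 0"
      by (simp only: zero norm_zero less_irrefl of_bool_eq perm_avg_const finite)
    thus ?thesis by simp
  next
    case False
    define m where "m = \<mu> * sqrt Q"
    have m: "0 < m" using False \<mu>0 Q0 unfolding m_def
      by (metis less_eq_real_def mult_nonneg_nonneg real_sqrt_ge_zero)
    define t where "t = sqrt L / m"
    have t0: "0 \<le> t" using L m by (simp add: t_def)
    have l1: "(\<Sum>j<k. cmod (z j)) \<le> sqrt (real CARD('n)) * sqrt Q"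
    proof -
      have "(\<Sum>j<k. cmod (z j))\<^sup>2 \<le> real k * Q"
        unfolding Q_def by (rule sum_squared_le_card_sum_squares)
      also have "\<dots> \<le> real CARD('n) * Q" using k(1) Q0 by (intro mult_right_mono) auto
      finally show ?thesis by (simp add: real_le_rsqrt flip: real_sqrt_mult)
    qed
    have mean: "cmod (\<Sum>x\<in>UNIV. a x) * (\<Sum>j<k. cmod (z j)) \<le> m * p"
    proof -
      have "(\<Sum>x\<in>UNIV. a x) = (\<Sum>x\<in>UNIV - {i}. hinner (column i X) (column x X))"
        by (rule sum.mono_neutral_cong_right) (auto simp: a_def)
      hence "cmod (\<Sum>x\<in>UNIV. a x) \<le> (p - 1) * average_coherence X"
        using cmod_sum_hinner_le_average_coherence[OF \<open>1 < CARD('p)\<close>, of i X] by (simp add: p_def)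
      also have "\<dots> \<le> (p - 1) * (\<mu> / sqrt (real CARD('n)))"
        using avg p1 by (intro mult_left_mono) auto
      also have "\<dots> \<le> p * (\<mu> / sqrt (real CARD('n)))"
        using \<mu>0 by (intro mult_right_mono) auto
      finally have "cmod (\<Sum>x\<in>UNIV. a x) * (\<Sum>j<k. cmod (z j))
          \<le> (p * (\<mu> / sqrt (real CARD('n)))) * (sqrt (real CARD('n)) * sqrt Q)"
        using l1 \<mu>0 p1 by (intro mult_mono) (auto simp: sum_nonneg)
      thus ?thesis by (simp add: m_def mult_ac)
    qed
    have "perm_avg UNIV (\<lambda>\<pi>. of_bool (sqrt 2 * (10 * sqrt L * m) < cmod (\<Sum>j<k. z j * a (\<pi> ! j))))
      \<le> 4 * exp (2 * t\<^sup>2 * \<mu>\<^sup>2 * (\<Sum>j<k. (cmod (z j))\<^sup>2) + t * m - t * (10 * sqrt L * m))"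
      by (rule sampling_without_replacement_tail) (use k(2) a_le mean t0 L m in \<open>auto simp: p_def\<close>)
    also have "2 * t\<^sup>2 * \<mu>\<^sup>2 * (\<Sum>j<k. (cmod (z j))\<^sup>2) = 2 * (t * m)\<^sup>2"
      using Q0 by (simp add: Q_def m_def power_mult_distrib)
    also have "t * m = sqrt L" using m by (simp add: t_def)
    also have "t * (10 * sqrt L * m) = 10 * L" using m L by (simp add: t_def)
    also have "2 * (sqrt L)\<^sup>2 + sqrt L - 10 * L \<le> - 7 * L"
    proof -
      have "sqrt L \<le> L" using L by (intro real_le_lsqrt) (auto simp: power2_eq_square)
      thus ?thesis using L by simp
    qed
    finally show ?thesis by (simp add: m_def mult_ac)
  qed
  thus ?thesis
    unfolding L_def Q_def a_def by (simp add: real_sqrt_mult mult_ac cong: if_cong)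
qed

theorem theorem6:
  fixes X :: "complex ^ 'p ^ 'n" and z :: "nat \<Rightarrow> complex" and k :: nat
  assumes dims: "0 < k" "k < CARD('n)" "CARD('n) \<le> CARD('p)"
    and p_ge: "128 \<le> CARD('p)"
    and unit_columns: "\<And>j. norm (column j X) = 1"
    and z_nonzero: "\<And>i. i < k \<Longrightarrow> z i \<noteq> 0"
    and coherence: "strong_coherence_property X"
    and k_le_spectral:
      "real k \<le> real CARD('p) / ((37 * exp 1)\<^sup>2 * (spectral_norm X)\<^sup>2 * ln (real CARD('p)))"
    and k_le_MAR:
      "\<And>\<pi>. \<pi> \<in> permutations_of_set (UNIV :: 'p set) \<Longrightarrow> worst_case_coherence X \<noteq> 0 \<Longrightarrow>
         real k \<le> inverse ((worst_case_coherence X)\<^sup>2) * MAR k (signal k z \<pi>) /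
                    (43\<^sup>2 * ln (real CARD('p)))"
  shows "measure_pmf.prob (pmf_of_set (permutations_of_set (UNIV :: 'p set)))
           {\<pi>. let \<beta> = signal k z \<pi>; y = X *v \<beta>
                in ost X y (ost_threshold X y) \<noteq> \<beta>}
         \<le> 6 / real CARD('p)"
proof -
  define p where "p = real CARD('p)"
  define L where "L = ln p"
  define \<mu> where "\<mu> = worst_case_coherence X"
  define Q where "Q = (\<Sum>j<k. (cmod (z j))\<^sup>2)"
  define dependent where "dependent \<pi> \<longleftrightarrow> \<not> columns_independent X (set (take k \<pi>))" for \<pi> :: "'p list"
  define dev where "dev i \<pi> = cmod (\<Sum>j<k. z j * (if \<pi> ! j = i then 0 else hinner (column i X) (column (\<pi> ! j) X)))"
    for i and \<pi> :: "'p list"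
  define E where "E = 10 * \<mu> * sqrt (2 * L) * sqrt Q"
  have p: "128 \<le> p" "0 < p" using p_ge by (simp_all add: p_def)
  have L: "4 \<le> L"
  proof -
    have "exp 4 = (exp 1 :: real) ^ 4" by (simp flip: exp_of_nat_mult)
    also have "\<dots> \<le> (272 / 100) ^ 4" using e_less_272 by (intro power_mono) auto
    also have "\<dots> \<le> 128" by (simp add: power_divide)
    finally have "exp 4 \<le> p" using p by simp
    thus ?thesis unfolding L_def using p by (simp add: ln_ge_iff)
  qed
  have expL: "exp L = p" using p by (simp add: L_def)
  \<comment> \<open>From \<open>2 \<le> exp 1\<close> alone, \<open>60 * exp 1\<close> is at least 100 and \<open>(37 * exp 1)\<^sup>2\<close> at least 5000.\<close>
  have e2: "2 \<le> (exp 1 :: real)" using exp_ge_add_one_self[of "1 :: real"] by simp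
  have coh: "cmod (hinner (column i X) (column j X)) \<le> \<mu>" if "i \<noteq> j" for i j
    unfolding \<mu>_def by (rule cmod_hinner_le_worst_case_coherence[OF that])
  have \<mu>_le: "\<mu> \<le> 1 / (100 * L)"
  proof -
    have "\<mu> \<le> 1 / (60 * exp 1 * L)"
      using coherence by (simp add: strong_coherence_property_def \<mu>_def L_def p_def)
    also have "\<dots> \<le> 1 / (100 * L)"
      using e2 L by (intro divide_left_mono mult_right_mono) auto
    finally show ?thesis .
  qed
  have spectral: "real k * (spectral_norm X)\<^sup>2 * (5000 * L) \<le> p"
  proof -
    let ?S = "(spectral_norm X)\<^sup>2"
    have S: "1 \<le> ?S" by (rule one_le_spectral_norm_squared) (rule unit_columns)
    have "(37 * 2)\<^sup>2 \<le> (37 * exp 1 :: real)\<^sup>2" using e2 by (intro power_mono) auto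
    hence c: "5000 \<le> (37 * exp 1 :: real)\<^sup>2" by (simp add: power2_eq_square)
    have "real k * ?S * (5000 * L) \<le> real k * ?S * ((37 * exp 1)\<^sup>2 * L)"
      using c L by (intro mult_left_mono mult_right_mono) auto
    also have "\<dots> = real k * ((37 * exp 1)\<^sup>2 * ?S * L)" by (simp only: mult_ac)
    also have "\<dots> \<le> p"
    proof -
      have "0 < (37 * exp 1)\<^sup>2 * ?S * L" using S L by (intro mult_pos_pos) auto
      thus ?thesis
        using k_le_spectral unfolding p_def[symmetric] L_def[symmetric] by (simp only: pos_le_divide_eq)
    qed
    finally show ?thesis .
  qed
  have k_half: "2 * k \<le> CARD('p)"
  proof -
    have "1 \<le> (spectral_norm X)\<^sup>2" by (rule one_le_spectral_norm_squared) (rule unit_columns)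
    hence "real k * 1 * 2 \<le> real k * (spectral_norm X)\<^sup>2 * (5000 * L)"
      using L by (intro mult_mono) auto
    thus ?thesis using spectral unfolding p_def by linarith
  qed
  have "1 < CARD('p)" using p_ge by simp
  then obtain i1 i2 :: 'p where "i1 \<noteq> i2"
    by (metis One_nat_def UNIV_I card_le_Suc0_iff_eq finite not_le)
  have \<mu>0: "0 \<le> \<mu>" using coh[OF \<open>i1 \<noteq> i2\<close>] norm_ge_zero order_trans by blast

  have recovery: "ost X (X *v signal k z \<pi>) (ost_threshold X (X *v signal k z \<pi>)) = signal k z \<pi>"
    if \<pi>: "\<pi> \<in> permutations_of_set UNIV" and indep: "\<not> dependent \<pi>" and dev: "\<And>i. dev i \<pi> \<le> E" for \<pi>
  proof -
    let ?\<beta> = "signal k z \<pi>"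
    have \<pi>': "distinct \<pi>" "k \<le> length \<pi>"
      using permutations_of_setD[OF \<pi>] length_finite_permutations_of_set[OF \<pi>] k_half by auto
    note model = true_model_signal[OF \<pi>' z_nonzero]
    have "(norm ?\<beta>)\<^sup>2 = Q" unfolding Q_def by (rule norm_signal_squared[OF \<pi>'])
    hence norm_\<beta>: "norm ?\<beta> = sqrt Q" by (metis norm_ge_zero real_sqrt_unique)
    have large: "43 * \<mu> * sqrt L * norm ?\<beta> \<le> cmod (?\<beta> $ i)" if i: "i \<in> true_model ?\<beta>" for i
    proof (cases "\<mu> = 0")
      case False
      have \<beta>: "0 < norm ?\<beta>" using i by (auto simp: true_model_def)
      have bmin: "0 \<le> beta_min ?\<beta>" "beta_min ?\<beta> \<le> cmod (?\<beta> $ i)"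
      proof -
        have mem: "cmod (?\<beta> $ i) \<in> (\<lambda>i. cmod (?\<beta> $ i)) ` true_model ?\<beta>" using i by blast
        thus "beta_min ?\<beta> \<le> cmod (?\<beta> $ i)" unfolding beta_min_def by (intro Min_le) auto
        show "0 \<le> beta_min ?\<beta>" unfolding beta_min_def using mem by (subst Min_ge_iff) auto
      qed
      have "real k \<le> inverse (\<mu>\<^sup>2) * ((beta_min ?\<beta>)\<^sup>2 / ((norm ?\<beta>)\<^sup>2 / real k)) / (43\<^sup>2 * L)"
        using k_le_MAR[OF \<pi>] False by (simp add: MAR_def \<mu>_def L_def p_def)
      also have "\<dots> = real k * ((beta_min ?\<beta>)\<^sup>2 / (43 * \<mu> * sqrt L * norm ?\<beta>)\<^sup>2)"
        using L by (simp add: power_mult_distrib field_simps)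
      finally have "1 \<le> (beta_min ?\<beta>)\<^sup>2 / (43 * \<mu> * sqrt L * norm ?\<beta>)\<^sup>2"
        by (intro mult_left_le_imp_le[of "real k" 1]) (use dims(1) in simp_all)
      hence "(43 * \<mu> * sqrt L * norm ?\<beta>)\<^sup>2 \<le> (beta_min ?\<beta>)\<^sup>2"
        using False L \<beta> by (subst (asm) le_divide_eq_1_pos) auto
      hence "43 * \<mu> * sqrt L * norm ?\<beta> \<le> beta_min ?\<beta>" using bmin(1) by (rule power2_le_imp_le)
      thus ?thesis using bmin(2) by linarith
    qed simp
    have "cmod (hinner (column i X) (X *v ?\<beta>) - ?\<beta> $ i) \<le> 10 * \<mu> * sqrt (2 * L) * norm ?\<beta>" for i
      using dev[of i] unfolding hinner_column_mult_minus_nth[OF unit_columns] sum_signal_mult dev_def E_def norm_\<beta> .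
    hence "ost_model X (X *v ?\<beta>) (ost_threshold X (X *v ?\<beta>)) = true_model ?\<beta>"
      using large \<mu>0 L unfolding \<mu>_def L_def p_def by (intro ost_model_eq_true_model) auto
    thus ?thesis using indep model by (intro ost_recovers) (simp_all add: dependent_def)
  qed

  have "measure_pmf.prob (pmf_of_set (permutations_of_set (UNIV :: 'p set)))
           {\<pi>. let \<beta> = signal k z \<pi>; y = X *v \<beta> in ost X y (ost_threshold X y) \<noteq> \<beta>}
      = perm_avg UNIV (\<lambda>\<pi> :: 'p list. of_bool (let \<beta> = signal k z \<pi>; y = X *v \<beta> in ost X y (ost_threshold X y) \<noteq> \<beta>))"
    by (rule prob_eq_perm_avg) simp
  also have "\<dots> \<le> perm_avg UNIV (\<lambda>\<pi>. of_bool (dependent \<pi>) + (\<Sum>i\<in>UNIV. of_bool (E < dev i \<pi>)))"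
  proof (rule perm_avg_mono)
    fix \<pi> :: "'p list" assume \<pi>: "\<pi> \<in> permutations_of_set UNIV"
    show "of_bool (let \<beta> = signal k z \<pi>; y = X *v \<beta> in ost X y (ost_threshold X y) \<noteq> \<beta>)
      \<le> of_bool (dependent \<pi>) + (\<Sum>i\<in>UNIV. of_bool (E < dev i \<pi>) :: real)"
    proof (cases "dependent \<pi> \<or> (\<exists>i. E < dev i \<pi>)")
      case True
      have one_le: "1 \<le> of_bool (dependent \<pi>) + (\<Sum>i\<in>UNIV. of_bool (E < dev i \<pi>) :: real)"
      proof (cases "dependent \<pi>")
        case False
        with True obtain i where "E < dev i \<pi>" by blast
        hence "1 = (of_bool (E < dev i \<pi>) :: real)" by simp
        also have "\<dots> \<le> (\<Sum>i\<in>UNIV. of_bool (E < dev i \<pi>) :: real)"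
          by (rule member_le_sum) auto
        finally show ?thesis by simp
      qed (simp add: sum_nonneg)
      show ?thesis by (rule order_trans[OF _ one_le]) (simp add: of_bool_def)
    next
      case False
      thus ?thesis using recovery[OF \<pi>] by (auto simp: Let_def not_less sum_nonneg)
    qed
  qed
  also have "\<dots> = perm_avg UNIV (\<lambda>\<pi>. of_bool (dependent \<pi>)) + (\<Sum>i\<in>UNIV. perm_avg UNIV (\<lambda>\<pi>. of_bool (E < dev i \<pi>)))"
    by (simp only: perm_avg_add perm_avg_sum)
  also have "\<dots> \<le> 1 / p + (\<Sum>i\<in>(UNIV :: 'p set). 4 * exp (- 7 * L))"
  proof (intro add_mono sum_mono)
    show "perm_avg UNIV (\<lambda>\<pi>. of_bool (dependent \<pi>)) \<le> 1 / p"
      unfolding dependent_def p_def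
    proof (rule prob_support_columns_dependent_le[OF unit_columns])
      show "cmod (hinner (column i X) (column j X)) \<le> 1 / (100 * ln (real CARD('p)))" if "i \<noteq> j" for i j
        using coh[OF that] \<mu>_le by (simp add: L_def p_def)
    qed (use L spectral in \<open>simp_all add: L_def p_def\<close>)
    show "perm_avg UNIV (\<lambda>\<pi>. of_bool (E < dev i \<pi>)) \<le> 4 * exp (- 7 * L)" for i
      unfolding E_def dev_def \<mu>_def L_def p_def Q_def
      by (rule prob_correlation_deviation_le)
         (use L coherence dims k_half in \<open>auto simp: L_def p_def strong_coherence_property_def\<close>)
  qed
  also have "\<dots> \<le> 6 / p"
  proof -
    have "(\<Sum>i\<in>(UNIV :: 'p set). 4 * exp (- 7 * L)) = 4 * (p * exp (- 7 * L))" by (simp add: p_def)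
    also have "p * exp (- 7 * L) = exp (- 6 * L)"
      by (subst expL[symmetric]) (simp flip: exp_add)
    also have "exp (- 6 * L) \<le> exp (- L)" using L by simp
    also have "exp (- L) = 1 / p" by (simp add: exp_minus expL inverse_eq_divide)
    finally show ?thesis using p by (simp add: field_simps)
  qed
  finally show ?thesis unfolding p_def .
qed

end
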